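(* Let $V$ be a three-dimensional real vector space. Then the map $b\mapsto \operatorname{SO}(V;b)$ induces a bijection $$\{\text{scalar products on } V\}/\mathbb{R}_{>0}\;\overset{\sim}{\longrightarrow}\;\{\text{rotation groups } D\subset \operatorname{GL}(V)\},$$ where $\mathbb{R}_{>0}$ acts on scalar products by multiplication with positive scalars.
   Context: A scalar product on a real vector space $V$ is a symmetric positive definite bilinear form $b:V\times V\to\mathbb{R}$. For such $b$, $\operatorname{SO}(V;b)=\{d\in\operatorname{GL}(V)\mid b(dv,dw)=b(v,w)\ \forall v,w\in V \text{ and } \det d=1\}$. A ray in a real vector space $V$ is a subset $L\subset V$ of the form $L=\mathbb{R}_{\geq 0}v$ for some $v\neq 0$. A half-plane in $V$ is a subset $H\subset V$ of the form $H=\mathbb{R}v+\mathbb{R}_{\geq 0}w$ for some linearly independent $v,w\in V$; its boundary is the unique line (one-dimensional linear subspace) contained in it, namely $\mathbb{R}v$. A rotation group in a three-dimensional real vector space $V$ is a subgroup $D\subset\operatorname{GL}(V)$ such that for any two pairs $(H,L)$, $(H',L')$, each consisting of a half-plane and a ray contained in its boundary, there is exactly one $d\in D$ with $d(H)=H'$ and $d(L)=L'$. No topological condition on $D$ is assumed. *)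

theory Defs
  imports "HOL-Analysis.Analysis" "HOL-Algebra.Group"
begin

definition ordered_basis :: "('n \<Rightarrow> 'a::real_vector) \<Rightarrow> bool" where
  "ordered_basis e \<longleftrightarrow> inj e \<and> independent (range e) \<and> span (range e) = UNIV"

definition coord :: "('n \<Rightarrow> 'a::real_vector) \<Rightarrow> 'a \<Rightarrow> 'n \<Rightarrow> real" where
  "coord e v i = representation (range e) v (e i)"

text \<open>The library's \<open>matrix\<close> is only for maps between spaces \<open>real^'n\<close>.\<close>

definition endo_matrix :: "('n::finite \<Rightarrow> 'a::real_vector) \<Rightarrow> ('a \<Rightarrow> 'a) \<Rightarrow> real^'n^'n" where
  "endo_matrix e f = (\<chi> i j. coord e (f (e j)) i)"

text \<open>
  Determinant of an endomorphism of a three-dimensional space. The basis exists by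
  \<open>ex_ordered_basis_3\<close>, and by \<open>endo_det_eq\<close> the value does not depend on its choice.
\<close>

definition endo_det :: "('a::real_vector \<Rightarrow> 'a) \<Rightarrow> real" where
  "endo_det f = det (endo_matrix (SOME e :: 3 \<Rightarrow> 'a. ordered_basis e) f)"

definition GL :: "('a::real_vector \<Rightarrow> 'a) monoid" where
  "GL = \<lparr>carrier = {d. linear d \<and> bij d}, mult = (\<circ>), one = id\<rparr>"

definition scalar_products :: "('a::real_vector \<Rightarrow> 'a \<Rightarrow> real) set" where
  "scalar_products = {b. bilinear b \<and> (\<forall>v w. b v w = b w v) \<and> (\<forall>v. v \<noteq> 0 \<longrightarrow> b v v > 0)}"

text \<open>The classes of this relation are the orbits of the scaling action of the positive reals.\<close>

definition positive_multiple ::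
    "(('a::real_vector \<Rightarrow> 'a \<Rightarrow> real) \<times> ('a \<Rightarrow> 'a \<Rightarrow> real)) set" where
  "positive_multiple =
     {(b, b'). b \<in> scalar_products \<and> b' \<in> scalar_products \<and> (\<exists>c>0. b' = (\<lambda>v w. c * b v w))}"

definition SO :: "('a::real_vector \<Rightarrow> 'a \<Rightarrow> real) \<Rightarrow> ('a \<Rightarrow> 'a) set" where
  "SO b = {d \<in> carrier GL. (\<forall>v w. b (d v) (d w) = b v w) \<and> endo_det d = 1}"

definition is_ray :: "'a::real_vector set \<Rightarrow> bool" where
  "is_ray L \<longleftrightarrow> (\<exists>v. v \<noteq> 0 \<and> L = {t *\<^sub>R v | t. t \<ge> 0})"

definition is_half_plane :: "'a::real_vector set \<Rightarrow> bool" where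
  "is_half_plane H \<longleftrightarrow>
     (\<exists>v w. v \<noteq> w \<and> independent {v, w} \<and> H = {s *\<^sub>R v + t *\<^sub>R w | s t. t \<ge> 0})"

definition is_line :: "'a::real_vector set \<Rightarrow> bool" where
  "is_line l \<longleftrightarrow> subspace l \<and> dim l = 1"

definition boundary_line :: "'a::real_vector set \<Rightarrow> 'a set" where
  "boundary_line H = (THE l. is_line l \<and> l \<subseteq> H)"

definition is_flag :: "'a::real_vector set \<Rightarrow> 'a set \<Rightarrow> bool" where
  "is_flag H L \<longleftrightarrow> is_half_plane H \<and> is_ray L \<and> L \<subseteq> boundary_line H"

definition rotation_group :: "('a::real_vector \<Rightarrow> 'a) set \<Rightarrow> bool" where
  "rotation_group D \<longleftrightarrow> subgroup D GL \<and>
     (\<forall>H L H' L'. is_flag H L \<longrightarrow> is_flag H' L' \<longrightarrow> (\<exists>!d. d \<in> D \<and> d ` H = H' \<and> d ` L = L'))"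

lemma group_GL: "group (GL :: ('a::real_vector \<Rightarrow> 'a) monoid)"
proof (rule groupI)
  fix x :: "'a \<Rightarrow> 'a" assume x: "x \<in> carrier GL"
  have "linear (the_inv x)"
  proof -
    have i: "x (the_inv x y) = y" for y
      using x by (simp add: GL_def bij_def f_the_inv_into_f)
    have j: "the_inv x (x y) = y" for y
      using x by (simp add: GL_def bij_def the_inv_f_f)
    have l: "linear x" using x by (simp add: GL_def)
    show ?thesis
    proof (rule linearI)
      fix a b r
      have "x (the_inv x a + the_inv x b) = a + b" by (simp add: linear_add[OF l] i)
      then show "the_inv x (a + b) = the_inv x a + the_inv x b" by (metis j)
      have "x (r *\<^sub>R the_inv x a) = r *\<^sub>R a" by (simp add: linear_scale[OF l] i)
      then show "the_inv x (r *\<^sub>R a) = r *\<^sub>R the_inv x a" by (metis j)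
    qed
  qed
  moreover have "bij (the_inv x)"
    using x by (simp add: GL_def bij_betw_the_inv_into)
  moreover have "the_inv x \<circ> x = id"
    using x by (auto simp: GL_def bij_def the_inv_f_f)
  ultimately have "the_inv x \<in> carrier GL" "the_inv x \<circ> x = id"
    by (auto simp: GL_def)
  then show "\<exists>y\<in>carrier GL. y \<otimes>\<^bsub>GL\<^esub> x = \<one>\<^bsub>GL\<^esub>"
    by (auto simp: GL_def)
qed (auto simp: GL_def linear_compose linear_id bij_comp o_assoc)

lemma equiv_positive_multiple:
  "equiv scalar_products (positive_multiple :: (('a::real_vector \<Rightarrow> 'a \<Rightarrow> real) \<times> _) set)"
proof (rule equivI)
  show "refl_on scalar_products (positive_multiple :: (('a \<Rightarrow> 'a \<Rightarrow> real) \<times> _) set)"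
    by (auto simp: refl_on_def positive_multiple_def intro!: exI[of _ 1])
  show "sym (positive_multiple :: (('a \<Rightarrow> 'a \<Rightarrow> real) \<times> _) set)"
  proof (rule symI)
    fix b b' :: "'a \<Rightarrow> 'a \<Rightarrow> real" assume "(b, b') \<in> positive_multiple"
    then obtain c where "c > 0" "b' = (\<lambda>v w. c * b v w)"
        and "b \<in> scalar_products" "b' \<in> scalar_products"
      by (auto simp: positive_multiple_def)
    then show "(b', b) \<in> positive_multiple"
      by (auto simp: positive_multiple_def fun_eq_iff intro!: exI[of _ "inverse c"])
  qed
  show "trans (positive_multiple :: (('a \<Rightarrow> 'a \<Rightarrow> real) \<times> _) set)"
  proof (rule transI)
    fix b b' b'' :: "'a \<Rightarrow> 'a \<Rightarrow> real"
    assume "(b, b') \<in> positive_multiple" "(b', b'') \<in> positive_multiple"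
    then obtain c c' where "c > 0" "b' = (\<lambda>v w. c * b v w)" "c' > 0" "b'' = (\<lambda>v w. c' * b' v w)"
        and "b \<in> scalar_products" "b'' \<in> scalar_products"
      by (auto simp: positive_multiple_def)
    then show "(b, b'') \<in> positive_multiple"
      by (auto simp: positive_multiple_def mult.assoc intro!: exI[of _ "c' * c"])
  qed
qed (auto simp: positive_multiple_def)

lemma scale_scalar_product:
  "b \<in> scalar_products \<Longrightarrow> c > 0 \<Longrightarrow> (\<lambda>v w. c * b v w) \<in> scalar_products"
  by (auto simp: scalar_products_def bilinear_def linear_iff algebra_simps)

lemma coord_sum:
  fixes e :: "'n::finite \<Rightarrow> 'a::real_vector"
  assumes "ordered_basis e"
  shows "(\<Sum>i\<in>UNIV. coord e v i *\<^sub>R e i) = v"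
proof -
  have "(\<Sum>b\<in>range e. representation (range e) v b *\<^sub>R b) = v"
    using assms by (intro real_vector.sum_representation_eq) (auto simp: ordered_basis_def)
  then show ?thesis
    using assms by (simp add: sum.reindex ordered_basis_def coord_def)
qed

lemma linear_coord:
  "ordered_basis e \<Longrightarrow> linear (\<lambda>v. coord e v i)"
  unfolding coord_def ordered_basis_def
  by (intro linearI) (auto simp: real_vector.representation_add real_vector.representation_scale)

lemma coord_basis:
  "ordered_basis e \<Longrightarrow> coord e (e j) i = (if i = j then 1 else 0)"
  unfolding coord_def ordered_basis_def
  by (auto simp: real_vector.representation_basis inj_eq)

lemma coord_expand:
  fixes e e' :: "'n::finite \<Rightarrow> 'a::real_vector"
  assumes "ordered_basis e" "ordered_basis e'" "linear f"
  shows "(\<Sum>k\<in>UNIV. coord e (f (e' k)) i * coord e' v k) = coord e (f v) i"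
proof -
  have l: "linear (\<lambda>v. coord e (f v) i)"
    using linear_compose[OF assms(3) linear_coord[OF assms(1)]] by (simp add: o_def)
  have "coord e (f v) i = coord e (f (\<Sum>k\<in>UNIV. coord e' v k *\<^sub>R e' k)) i"
    using coord_sum[OF assms(2)] by simp
  also have "\<dots> = (\<Sum>k\<in>UNIV. coord e (f (e' k)) i * coord e' v k)"
    by (simp add: linear_sum[OF l] linear_scale[OF l] mult.commute)
  finally show ?thesis ..
qed

lemma det_endo_matrix_basis_independent:
  fixes e e' :: "'n::finite \<Rightarrow> 'a::real_vector"
  assumes e: "ordered_basis e" and e': "ordered_basis e'" and f: "linear f"
  shows "det (endo_matrix e f) = det (endo_matrix e' f)"
proof -
  define P :: "real^'n^'n" where "P = (\<chi> i j. coord e (e' j) i)"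
  define Q :: "real^'n^'n" where "Q = (\<chi> i j. coord e' (e j) i)"
  have "P ** Q = mat 1"
    using coord_expand[OF e e' linear_id]
    by (simp add: P_def Q_def matrix_matrix_mult_def mat_def vec_eq_iff coord_basis[OF e])
  then have "det P * det Q = 1" by (metis det_mul det_I)
  then have "det P \<noteq> 0" by auto
  moreover have "endo_matrix e f ** P = P ** endo_matrix e' f"
    using coord_expand[OF e e f] coord_expand[OF e e' linear_id]
    by (simp add: P_def endo_matrix_def matrix_matrix_mult_def vec_eq_iff)
  then have "det (endo_matrix e f) * det P = det P * det (endo_matrix e' f)"
    by (metis det_mul)
  ultimately show ?thesis by simp
qed

lemma ex_ordered_basis_3:
  assumes "dim (UNIV :: 'a::real_vector set) = 3"
  shows "\<exists>e :: 3 \<Rightarrow> 'a. ordered_basis e"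
proof -
  obtain B :: "'a set" where B: "independent B" "UNIV \<subseteq> span B" "card B = 3"
    using real_vector.basis_exists[of "UNIV :: 'a set"] assms by metis
  then have "finite B" by (metis card.infinite zero_neq_numeral)
  then obtain e :: "3 \<Rightarrow> 'a" where "bij_betw e UNIV B"
    using B(3) finite_same_card_bij[of "UNIV :: 3 set" B] by auto
  then have "ordered_basis e"
    using B by (auto simp: ordered_basis_def bij_betw_def)
  then show ?thesis by blast
qed

lemma endo_det_eq:
  fixes e :: "3 \<Rightarrow> 'a::real_vector"
  assumes "ordered_basis e" "linear f"
  shows "endo_det f = det (endo_matrix e f)"
  unfolding endo_det_def
  using assms by (intro det_endo_matrix_basis_independent someI[of ordered_basis e])

lemma boundary_line_half_plane:
  fixes v w :: "'a::real_vector"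
  assumes "v \<noteq> w" "independent {v, w}"
  shows "boundary_line {s *\<^sub>R v + t *\<^sub>R w | s t. t \<ge> 0} = span {v}"
proof -
  let ?H = "{s *\<^sub>R v + t *\<^sub>R w | s t. t \<ge> 0}"
  have v: "v \<noteq> 0" and wv: "w \<notin> span {v}"
    using assms real_vector.independent_insert[of w "{v}"]
    by (auto simp: insert_commute dependent_zero)
  have wk: "r = 0" if "r *\<^sub>R w \<in> span {v}" for r
    using wv span_scale[OF that, of "inverse r"] by (cases "r = 0") auto
  have indv: "independent {v}" using v by (simp add: dependent_single)
  show ?thesis
    unfolding boundary_line_def
  proof (rule the_equality)
    have "span {v} \<subseteq> ?H"
    proof
      fix x assume "x \<in> span {v}"
      then obtain s where "x = s *\<^sub>R v" by (auto simp: span_singleton)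
      then have "x = s *\<^sub>R v + 0 *\<^sub>R w" by simp
      then show "x \<in> ?H" by blast
    qed
    then show "is_line (span {v}) \<and> span {v} \<subseteq> ?H"
      using real_vector.dim_eq_card_independent[OF indv] by (simp add: is_line_def)
  next
    fix l assume l: "is_line l \<and> l \<subseteq> ?H"
    then have sl: "subspace l" and dl: "dim l = 1" and lH: "l \<subseteq> ?H" by (auto simp: is_line_def)
    have sub: "l \<subseteq> span {v}"
    proof
      fix x assume x: "x \<in> l"
      then obtain s t where st: "x = s *\<^sub>R v + t *\<^sub>R w" "t \<ge> 0" using lH by blast
      have "- x \<in> l" using x sl by (simp add: subspace_neg)
      then obtain s' t' where st': "- x = s' *\<^sub>R v + t' *\<^sub>R w" "t' \<ge> 0" using lH by blast
      have "(s *\<^sub>R v + t *\<^sub>R w) + (s' *\<^sub>R v + t' *\<^sub>R w) = 0"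
        using st(1) st'(1) by (metis add.right_inverse)
      then have "(t + t') *\<^sub>R w = (- (s + s')) *\<^sub>R v"
        by (simp add: algebra_simps add_eq_0_iff)
      then have "t + t' = 0" using wk by (metis span_base span_scale insertI1)
      then have "t = 0" using st(2) st'(2) by simp
      then show "x \<in> span {v}" using st by (simp add: span_base span_scale)
    qed
    obtain B where B: "B \<subseteq> l" "independent B" "l \<subseteq> span B" "card B = 1"
      using real_vector.basis_exists[of l] dl by metis
    then obtain x where "B = {x}" by (metis card_1_singletonE)
    then have x: "x \<in> l" "x \<noteq> 0" using B by (auto simp: dependent_single)
    then obtain k where k: "x = k *\<^sub>R v" using sub by (auto simp: span_singleton)
    then have "inverse k *\<^sub>R x = v" using x by auto
    then have "v \<in> l" using x(1) sl by (metis subspace_scale)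
    then have "span {v} \<subseteq> l" using sl by (simp add: span_minimal)
    then show "l = span {v}" using sub by auto
  qed
qed

end

theory Submission
  imports Defs
begin

text \<open>
  A rotation group \<open>D\<close> contains, for every line \<open>\<real>v\<close>, exactly one nontrivial involution fixing \<open>v\<close>;
  it exists because the square of the element taking a flag to its mirror image fixes the flag.
  Such a half-turn fixes only \<open>\<real>v\<close>, hence is \<open>-1\<close> on a complementary plane. Calling \<open>y\<close>
  orthogonal to \<open>x\<close> if the half-turn about \<open>x\<close> negates \<open>y\<close> gives a symmetric relation, because
  half-turns are conjugated into half-turns. It is thus a polarity of the real projective plane
  without self-conjugate points; as \<open>\<real>\<close> has no field endomorphism besides the identity, it is the
  orthogonality of a scalar product \<open>b\<close>. The half-turns of \<open>b\<close> lie in \<open>D\<close> and in \<open>SO b\<close> and already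
  act transitively on flags, so the uniqueness part of the definition forces \<open>D = SO b\<close>.
  Conversely \<open>SO b\<close> determines the orthogonality of \<open>b\<close>, and that determines \<open>b\<close> up to scaling.
\<close>

subsection \<open>Anisotropic orthogonality relations\<close>

text \<open>Positive numbers are squares, so \<open>F\<close> sends them to positive numbers and is
  strictly increasing. It fixes the rationals, and their density forces it to fix
  everything.\<close>

lemma real_field_endomorphism_eq_id:
  fixes F :: "real \<Rightarrow> real"
  assumes add: "\<And>x y. F (x + y) = F x + F y" and mult: "\<And>x y. F (x * y) = F x * F y"
    and one: "F 1 = 1"
  shows "F x = x"
proof -
  have F0: "F 0 = 0" using add[of 0 0] by simp
  have neg: "F (- x) = - F x" for x using add[of x "- x"] F0 by simp
  have diff: "F (x - y) = F x - F y" for x y using add[of x "- y"] neg by simp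
  have nz: "F x \<noteq> 0" if "x \<noteq> 0" for x
    using mult[of x "inverse x"] one that by auto
  have pos: "0 < F x" if "0 < x" for x
  proof -
    have "F x = F (sqrt x) * F (sqrt x)" using that by (simp flip: mult)
    then show ?thesis using nz[of x] that by (metis less_irrefl mult_eq_0_iff not_real_square_gt_zero)
  qed
  have mono: "F x < F y" if "x < y" for x y using pos[of "y - x"] that diff by simp
  have nat: "F (real n) = real n" for n by (induction n) (simp_all add: F0 add one)
  have int: "F (of_int k) = of_int k" for k
    by (cases k rule: int_cases2) (simp_all add: nat neg)
  have rat: "F q = q" if q: "q \<in> \<rat>" for q
  proof -
    obtain a b where ab: "b > 0" "q = of_int a / of_int b" using q by (rule Rats_cases')
    then have "q * of_int b = of_int a" by simp
    then have "F q * of_int b = q * of_int b" by (metis mult int)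
    then show ?thesis using ab(1) by simp
  qed
  show ?thesis
  proof (rule ccontr)
    assume "F x \<noteq> x"
    then consider "F x < x" | "x < F x" by linarith
    then show False
    proof cases
      case 1
      then obtain q where "q \<in> \<rat>" "F x < q" "q < x" using Rats_dense_in_real by blast
      then show False using mono[of q x] rat by simp
    next
      case 2
      then obtain q where "q \<in> \<rat>" "x < q" "q < F x" using Rats_dense_in_real by blast
      then show False using mono[of x q] rat by simp
    qed
  qed
qed

text \<open>The two vectors may coincide or vanish, so this also supplies vectors off a given line
  and nonzero vectors.\<close>

lemma ex_notin_span_pair:
  fixes u v :: "'a::real_vector"
  assumes "dim (UNIV :: 'a set) = 3"
  shows "\<exists>x. x \<notin> span {u, v}"
proof (rule ccontr)
  assume "\<not> ?thesis"
  then have *: "UNIV = span {u, v}" by auto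
  obtain B :: "'a set" where B: "independent B" "card B = 3"
    using real_vector.basis_exists[of "UNIV :: 'a set"] assms by metis
  have "card B \<le> card {u, v}"
    using real_vector.independent_span_bound[of "{u, v}" B] B * by auto
  moreover have "card {u, v} \<le> 2" by (simp add: card_insert_if)
  ultimately show False using B by simp
qed

text \<open>Positive \<open>dim\<close> encodes finite dimension, since an infinite basis has
  cardinality 0. A vector outside the span could be adjoined to \<open>S\<close>, giving an
  independent set larger than a basis.\<close>

lemma span_independent_card_dim:
  fixes S :: "'a::real_vector set"
  assumes "dim (UNIV :: 'a set) > 0" "independent S" "card S = dim (UNIV :: 'a set)"
  shows "span S = UNIV"
proof (rule ccontr)
  assume "span S \<noteq> UNIV"
  then obtain x where x: "x \<notin> span S" by auto
  obtain B :: "'a set" where B: "independent B" "UNIV \<subseteq> span B" "card B = dim (UNIV :: 'a set)"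
    using real_vector.basis_exists[of "UNIV :: 'a set"] by metis
  have fin: "finite B" "finite S" using B assms by (metis card_gt_0_iff)+
  have "x \<notin> S" using x span_base by blast
  then have "independent (insert x S)" using x assms(2) by (simp add: real_vector.independent_insert)
  then have "card (insert x S) \<le> card B"
    using real_vector.independent_span_bound[of B "insert x S"] B fin by auto
  then show False using \<open>x \<notin> S\<close> fin B assms by simp
qed

text \<open>
  In the associated projective plane this is a polarity without self-conjugate points:
  every point has a polar line not passing through it.
\<close>

locale orthogonality =
  fixes orth :: "'a::real_vector \<Rightarrow> 'a \<Rightarrow> bool"
  assumes dim3: "dim (UNIV :: 'a set) = 3"
    and sym: "orth x y \<Longrightarrow> orth y x"
    and add: "orth x y \<Longrightarrow> orth x z \<Longrightarrow> orth x (y + z)"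
    and scale: "orth x y \<Longrightarrow> orth x (c *\<^sub>R y)"
    and anisotropic: "orth x x \<Longrightarrow> x = 0"
    and projection: "x \<noteq> 0 \<Longrightarrow> \<exists>c. orth x (y - c *\<^sub>R x)"
begin

section \<open>Elementary rules for an orthogonality relation\<close>

lemma orth_0: "orth x 0"
proof (cases "x = 0")
  case False
  then show ?thesis using projection[of x 0] scale[of x _ 0] by auto
next
  case True
  \<comment> \<open>\<open>projection\<close> says nothing about \<open>x = 0\<close>; symmetry
    reduces this case to a nonzero vector.\<close>
  obtain y :: 'a where "y \<noteq> 0" using ex_notin_span_pair[OF dim3, of 0 0] span_0 by metis
  then obtain c where "orth y (0 - c *\<^sub>R y)" using projection by blast
  then show ?thesis using scale[of y _ 0] sym[of y 0] scale[of 0 y 0] True by simp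
qed

lemma diff: "orth x y \<Longrightarrow> orth x z \<Longrightarrow> orth x (y - z)"
  using add[of x y "- z"] scale[of x z "-1"] by simp

lemma sym_iff: "orth x y \<longleftrightarrow> orth y x" using sym by blast

lemma scale_iff: "c \<noteq> 0 \<Longrightarrow> orth x (c *\<^sub>R y) \<longleftrightarrow> orth x y"
  using scale[of x "c *\<^sub>R y" "inverse c"] scale by auto

lemma scale_left_iff: "c \<noteq> 0 \<Longrightarrow> orth (c *\<^sub>R x) y \<longleftrightarrow> orth x y"
  using scale_iff sym by blast

lemma add_iff: "orth x z \<Longrightarrow> orth x (y + z) \<longleftrightarrow> orth x y"
  using add[of x y z] diff[of x "y + z" z] by auto

lemma scale_self: "orth x (c *\<^sub>R x) \<Longrightarrow> x \<noteq> 0 \<Longrightarrow> c = 0"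
  using scale_iff anisotropic by blast

lemma ex_orth: "\<exists>y. y \<noteq> 0 \<and> orth x y"
proof (cases "x = 0")
  case True
  obtain y :: 'a where "y \<noteq> 0" using ex_notin_span_pair[OF dim3, of 0 0] span_0 by metis
  then show ?thesis using orth_0 sym True by blast
next
  case False
  obtain u where u: "u \<notin> span {x, x}" using ex_notin_span_pair[OF dim3] by blast
  obtain c where c: "orth x (u - c *\<^sub>R x)" using projection False by blast
  have "u - c *\<^sub>R x \<noteq> 0" using u by (auto simp: span_singleton)
  then show ?thesis using c by blast
qed

text \<open>Gram-Schmidt: as \<open>x\<close> and \<open>y\<close> are orthogonal, correcting
  \<open>u\<close> along one of them does not disturb its orthogonality to the other.\<close>

lemma ex_orth_pair:
  assumes "orth x y" "x \<noteq> 0" "y \<noteq> 0"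
  shows "\<exists>z. z \<noteq> 0 \<and> orth x z \<and> orth y z"
proof -
  obtain u where u: "u \<notin> span {x, y}" using ex_notin_span_pair[OF dim3] by blast
  obtain c where c: "orth x (u - c *\<^sub>R x)" using projection assms by blast
  obtain k where k: "orth y (u - k *\<^sub>R y)" using projection assms by blast
  let ?z = "u - c *\<^sub>R x - k *\<^sub>R y"
  have "?z \<noteq> 0"
  proof
    assume "?z = 0"
    then have "u = c *\<^sub>R x + k *\<^sub>R y" by (simp add: algebra_simps)
    moreover have "c *\<^sub>R x + k *\<^sub>R y \<in> span {x, y}"
      by (intro span_add span_scale span_base) auto
    ultimately show False using u by simp
  qed
  moreover have "orth x ?z" using diff[OF c scale[OF assms(1)]] .
  moreover have "orth y ?z"
    using diff[OF k scale[OF sym[OF assms(1)], of c]] by (simp add: algebra_simps)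
  ultimately show ?thesis by blast
qed

section \<open>Orthogonal frames as bases\<close>

definition frame :: "'a \<Rightarrow> 'a \<Rightarrow> 'a \<Rightarrow> bool" where
  "frame x y z \<longleftrightarrow> x \<noteq> 0 \<and> y \<noteq> 0 \<and> z \<noteq> 0 \<and> orth x y \<and> orth x z \<and> orth y z"

lemma frame_rotate: "frame x y z \<Longrightarrow> frame y z x"
  using sym by (auto simp: frame_def)

text \<open>The combination is orthogonal to \<open>x\<close>, as are its terms in \<open>y\<close>
  and \<open>z\<close>; what remains is a multiple of \<open>x\<close> orthogonal to
  \<open>x\<close>.\<close>

lemma frame_coeff_0:
  assumes "frame x y z" "a *\<^sub>R x + b *\<^sub>R y + c *\<^sub>R z = 0"
  shows "a = 0"
proof -
  have "orth x (a *\<^sub>R x + b *\<^sub>R y + c *\<^sub>R z)" using assms(2) orth_0 by simp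
  then have "orth x (a *\<^sub>R x)" using assms(1) by (simp add: frame_def add_iff scale)
  then show ?thesis using assms(1) scale_self by (auto simp: frame_def)
qed

lemma frame_coeffs_0:
  assumes "frame x y z" "a *\<^sub>R x + b *\<^sub>R y + c *\<^sub>R z = 0"
  shows "a = 0 \<and> b = 0 \<and> c = 0"
  using frame_coeff_0[OF assms] frame_coeff_0[OF frame_rotate[OF assms(1)], of b c a]
    frame_coeff_0[OF frame_rotate[OF frame_rotate[OF assms(1)]], of c a b] assms(2)
  by (simp add: algebra_simps)

lemma frame_basis:
  assumes "frame x y z"
  shows "independent {x, y, z}" "card {x, y, z} = 3" "span {x, y, z} = UNIV"
proof -
  note z = frame_coeffs_0[OF assms]
  have nx: "x \<noteq> 0" using assms by (simp add: frame_def)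
  have y: "y \<notin> span {x}"
  proof
    assume "y \<in> span {x}"
    then obtain k where "y = k *\<^sub>R x" by (auto simp: span_singleton)
    then show False using z[of k "-1" 0] by simp
  qed
  have zz: "z \<notin> span {y, x}"
  proof
    assume "z \<in> span {y, x}"
    then obtain k l where "z = k *\<^sub>R y + l *\<^sub>R x"
      by (auto simp: span_insert span_singleton algebra_simps)
    then show False using z[of l k "-1"] by (simp add: algebra_simps)
  qed
  have ne: "x \<noteq> y" "z \<noteq> x" "z \<noteq> y" using y zz span_base[of x "{x}"] span_base[of x "{y, x}"] span_base[of y "{y, x}"] by auto
  have "independent (insert z (insert y {x}))"
    using y zz nx ne by (simp add: real_vector.independent_insert)
  then show i: "independent {x, y, z}" by (simp add: insert_commute)
  show c: "card {x, y, z} = 3" using ne by auto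
  show "span {x, y, z} = UNIV"
  proof (rule span_independent_card_dim[OF _ i])
    show "0 < dim (UNIV :: 'a set)" unfolding dim3 by (rule zero_less_numeral)
    show "card {x, y, z} = dim (UNIV :: 'a set)" unfolding dim3 by (rule c)
  qed
qed

lemma frame_expand:
  assumes "frame x y z"
  obtains a b c where "v = a *\<^sub>R x + b *\<^sub>R y + c *\<^sub>R z"
proof -
  have "v \<in> span {x, y, z}" using frame_basis(3)[OF assms] by simp
  then obtain a b c where "v = a *\<^sub>R x + b *\<^sub>R y + c *\<^sub>R z"
    by (auto simp: span_insert span_singleton algebra_simps)
  then show ?thesis by (rule that)
qed

lemma ex_frame: "x \<noteq> 0 \<Longrightarrow> \<exists>y z. frame x y z"
  using ex_orth[of x] ex_orth_pair[of x] unfolding frame_def by blast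

section \<open>The equation of a polar line\<close>

lemma polar_slope:
  assumes "frame x y z"
  shows "\<exists>k. orth (x + s *\<^sub>R y) (y - k *\<^sub>R x)"
proof -
  have xy: "orth x y" "x \<noteq> 0" using assms by (auto simp: frame_def)
  have ne: "x + s *\<^sub>R y \<noteq> 0" using frame_coeff_0[OF assms, of 1 s 0] by auto
  then obtain c where c: "orth (x + s *\<^sub>R y) (y - c *\<^sub>R (x + s *\<^sub>R y))" using projection by blast
  have *: "y - c *\<^sub>R (x + s *\<^sub>R y) = (1 - c * s) *\<^sub>R y - c *\<^sub>R x" by (simp add: algebra_simps)
  \<comment> \<open>Otherwise the vector found by projection is a nonzero multiple of
    \<open>x\<close>, and \<open>x\<close> is orthogonal to \<open>x + s *\<^sub>R y\<close> only if
    it is orthogonal to itself. So the coefficient of \<open>y\<close> can be normalized to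
    1.\<close>
  have cs: "1 - c * s \<noteq> 0"
  proof
    assume 1: "1 - c * s = 0"
    then have "c \<noteq> 0" by auto
    have "orth (x + s *\<^sub>R y) ((-c) *\<^sub>R x)" using c * 1 by simp
    then have "orth x (x + s *\<^sub>R y)" using \<open>c \<noteq> 0\<close> scale_iff[of "-c"] sym by simp
    then have "orth x x" using add_iff scale xy by blast
    then show False using anisotropic xy by blast
  qed
  have "orth (x + s *\<^sub>R y) (inverse (1 - c * s) *\<^sub>R ((1 - c * s) *\<^sub>R y - c *\<^sub>R x))"
    using c * scale by metis
  then have "orth (x + s *\<^sub>R y) (y - (c / (1 - c * s)) *\<^sub>R x)"
    using cs by (simp add: scaleR_right_diff_distrib divide_inverse mult.commute)
  then show ?thesis by blast
qed

lemma frame_polar_function: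
  assumes "frame x y z"
  obtains f where "\<And>s. orth (x + s *\<^sub>R y) (y - f s *\<^sub>R x)"
  using polar_slope[OF assms] by metis

text \<open>The coefficients in the equation of the polar of
  \<open>x + s *\<^sub>R y + t *\<^sub>R z\<close> are functions \<open>f s\<close> and
  \<open>g t\<close> of one variable each; the work lies in showing that both are linear. The
  constants \<open>a\<close> and \<open>b\<close> are their values at 1.\<close>

lemma polar_coordinates:
  assumes "frame x y z"
  shows "\<exists>a b. \<forall>s t p q r. orth (x + s *\<^sub>R y + t *\<^sub>R z) (p *\<^sub>R x + q *\<^sub>R y + r *\<^sub>R z)
           \<longleftrightarrow> p + a * s * q + b * t * r = 0"
proof -
  have fr: "frame x z y" using assms sym by (auto simp: frame_def)
  have o: "orth x y" "orth x z" "orth y z" "x \<noteq> 0" "y \<noteq> 0" "z \<noteq> 0"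
    "orth y x" "orth z x" "orth z y"
    using assms sym by (auto simp: frame_def)
  obtain f where f: "\<And>s. orth (x + s *\<^sub>R y) (y - f s *\<^sub>R x)"
    by (rule frame_polar_function[OF assms]) blast
  obtain g where g: "\<And>t. orth (x + t *\<^sub>R z) (z - g t *\<^sub>R x)"
    by (rule frame_polar_function[OF fr]) blast
  \<comment> \<open>The vectors \<open>y - f s *\<^sub>R x\<close> and
    \<open>z - g t *\<^sub>R x\<close> both lie on the polar, because the third basis vector is
    orthogonal to each of them. Splitting them off leaves a multiple of \<open>x\<close>, which is
    not on the polar.\<close>
  have iff: "orth (x + s *\<^sub>R y + t *\<^sub>R z) (p *\<^sub>R x + q *\<^sub>R y + r *\<^sub>R z) \<longleftrightarrow> p + f s * q + g t * r = 0"
    for s t p q r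
  proof -
    let ?v = "x + s *\<^sub>R y + t *\<^sub>R z"
    have zp: "orth (y - f s *\<^sub>R x) z" using diff[of z y "f s *\<^sub>R x"] scale o sym by blast
    have yp: "orth (z - g t *\<^sub>R x) y" using diff[of y z "g t *\<^sub>R x"] scale o sym by blast
    have 1: "orth ?v (y - f s *\<^sub>R x)"
      using f[of s] zp add scale sym by blast
    have "orth (z - g t *\<^sub>R x) ((x + t *\<^sub>R z) + s *\<^sub>R y)"
      using g[of t] yp add scale sym by blast
    then have 2: "orth ?v (z - g t *\<^sub>R x)" using sym by (simp add: algebra_simps)
    have vx: "\<not> orth ?v x"
    proof
      assume "orth ?v x"
      then have "orth x ?v" by (rule sym)
      then have "orth x x" using o by (simp add: add_iff scale)
      then show False using anisotropic o by blast
    qed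
    have 3: "orth ?v (q *\<^sub>R (y - f s *\<^sub>R x) + r *\<^sub>R (z - g t *\<^sub>R x))"
      using 1 2 add scale by blast
    have "p *\<^sub>R x + q *\<^sub>R y + r *\<^sub>R z =
        (p + f s * q + g t * r) *\<^sub>R x + (q *\<^sub>R (y - f s *\<^sub>R x) + r *\<^sub>R (z - g t *\<^sub>R x))"
      by (simp add: algebra_simps)
    then have "orth ?v (p *\<^sub>R x + q *\<^sub>R y + r *\<^sub>R z) \<longleftrightarrow> orth ?v ((p + f s * q + g t * r) *\<^sub>R x)"
      using add_iff[OF 3] by simp
    also have "\<dots> \<longleftrightarrow> p + f s * q + g t * r = 0"
      using vx scale_iff[of "p + f s * q + g t * r" ?v x] orth_0[of ?v]
      by (cases "p + f s * q + g t * r = 0") simp_all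
    finally show ?thesis .
  qed
  have f0: "f 0 = 0" using iff[of 0 0 0 1 0] o by simp
  have g0: "g 0 = 0" using iff[of 0 0 0 0 1] o by simp
  have fn0: "f s \<noteq> 0" if "s \<noteq> 0" for s
  proof
    assume "f s = 0"
    then have "orth y (s *\<^sub>R y + x)" using iff[of s 0 0 1 0] sym by (simp add: add.commute)
    then show False using scale_self that o add_iff by metis
  qed
  have gn0: "g t \<noteq> 0" if "t \<noteq> 0" for t
  proof
    assume "g t = 0"
    then have "orth z (t *\<^sub>R z + x)" using iff[of 0 t 0 0 1] sym by (simp add: add.commute)
    then show False using scale_self that o add_iff by metis
  qed
  \<comment> \<open>The points without \<open>x\<close>-component: adding \<open>x\<close> to one
    side changes nothing, because the other side is orthogonal to it.\<close>
  have iff0: "orth (s *\<^sub>R y + t *\<^sub>R z) (q *\<^sub>R y + r *\<^sub>R z) \<longleftrightarrow> f s * q + g t * r = 0" for s t q r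
  proof -
    have "orth (q *\<^sub>R y + r *\<^sub>R z) x" using o add scale sym by blast
    then have "orth (q *\<^sub>R y + r *\<^sub>R z) ((s *\<^sub>R y + t *\<^sub>R z) + x)
        \<longleftrightarrow> orth (q *\<^sub>R y + r *\<^sub>R z) (s *\<^sub>R y + t *\<^sub>R z)"
      by (rule add_iff)
    then show ?thesis using iff[of s t 0 q r] sym_iff by (simp add: algebra_simps)
  qed
  \<comment> \<open>The polar does not change when its point is scaled by \<open>k\<close>; this is
    tested on a vector known to lie on the polar of
    \<open>s *\<^sub>R y + t *\<^sub>R z\<close>.\<close>
  have fg: "f (k * s) * g t = g (k * t) * f s" if "k \<noteq> 0" for k s t
  proof -
    have "orth (s *\<^sub>R y + t *\<^sub>R z) (g t *\<^sub>R y + (- f s) *\<^sub>R z)"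
      using iff0[of s t "g t" "- f s"] by simp
    then have "orth (k *\<^sub>R (s *\<^sub>R y + t *\<^sub>R z)) (g t *\<^sub>R y + (- f s) *\<^sub>R z)"
      using that scale_left_iff by blast
    then have "orth ((k * s) *\<^sub>R y + (k * t) *\<^sub>R z) (g t *\<^sub>R y + (- f s) *\<^sub>R z)"
      by (simp add: scaleR_add_right)
    then show ?thesis using iff0[of "k * s" "k * t" "g t" "- f s"] by simp
  qed
  define a where "a = f 1"
  define b where "b = g 1"
  have ab: "a \<noteq> 0" "b \<noteq> 0" using fn0[of 1] gn0[of 1] by (auto simp: a_def b_def)
  txt \<open>
    Up to constants \<open>f\<close> and \<open>g\<close> are one and the same multiplicative function \<open>F\<close>; the symmetry of
    \<open>orth\<close>, tested against \<open>x + y + z\<close>, makes it additive.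
  \<close>
  define F where "F s = f s / a" for s
  have F1: "F 1 = 1" and F0: "F 0 = 0" and Fn0: "s \<noteq> 0 \<Longrightarrow> F s \<noteq> 0" for s
    using ab f0 fn0 by (auto simp: F_def a_def)
  have fF: "f s = a * F s" for s using ab by (simp add: F_def)
  have gF: "g s = b * F s" for s
    using fg[of s 1 1] ab f0 g0 by (cases "s = 0") (auto simp: F_def a_def b_def field_simps)
  have Fmult: "F (k * s) = F k * F s" for k s
    using fg[of k s 1] ab F0 by (cases "k = 0") (auto simp: fF gF F1)
  have key: "1 + a * F s + b * F t = 0" if "1 + a * s + b * t = 0" for s t
  proof -
    have "orth (x + 1 *\<^sub>R y + 1 *\<^sub>R z) (1 *\<^sub>R x + s *\<^sub>R y + t *\<^sub>R z)"
      using iff[of 1 1 1 s t] that by (simp add: a_def b_def)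
    then have "orth (x + s *\<^sub>R y + t *\<^sub>R z) (1 *\<^sub>R x + 1 *\<^sub>R y + 1 *\<^sub>R z)"
      using sym by simp
    then show ?thesis using iff[of s t 1 1 1] by (simp add: fF gF)
  qed
  have inv: "F (u / c) = F u / F c" if "c \<noteq> 0" for u c
    using Fmult[of "u / c" c] that Fn0[of c] by (simp add: field_simps)
  \<comment> \<open>With \<open>u = a * s\<close>, \<open>key\<close> becomes an identity in the
    single variable \<open>u\<close>. Its values at -1 and 0 express both constants through the sign
    \<open>e\<close>.\<close>
  define e where "e = F (- 1)"
  have ee: "e * e = 1" using Fmult[of "-1" "-1"] F1 by (simp add: e_def)
  have key': "1 + (a / F a) * F u + (b / F b) * F (- 1 - u) = 0" for u
    using key[of "u / a" "(- 1 - u) / b"] ab by (simp add: inv)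
  have "1 + (a / F a) * e = 0" using key'[of "-1"] F0 by (simp add: e_def)
  moreover have "1 + (b / F b) * e = 0" using key'[of 0] F0 by (simp add: e_def)
  ultimately have A: "a / F a = - e" "b / F b = - e" using ee by algebra+
  have s1: "F (1 + u) = 1 - e * F u" for u
  proof -
    have "F (- 1 - u) = e * F (1 + u)" using Fmult[of "-1" "1 + u"] by (simp add: e_def)
    then show ?thesis using key'[of u] ee A by algebra
  qed
  \<comment> \<open>If \<open>e\<close> were 1, then \<open>F 2\<close> would vanish.\<close>
  have "e \<noteq> 1" using s1[of 1] Fn0[of 2] F1 by auto
  then have "e = - 1" using ee by algebra
  then have succ: "F (1 + u) = 1 + F u" for u using s1 by simp
  \<comment> \<open>Compatibility with adding 1 suffices: the factor \<open>u\<close> can be pulled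
    out by multiplicativity.\<close>
  have "F (u + v) = F u + F v" for u v
  proof (cases "u = 0")
    case False
    then have "F (u + v) = F u * F (1 + v / u)" by (simp add: distrib_left flip: Fmult)
    also have "\<dots> = F u + F u * F (v / u)" by (simp add: succ distrib_left)
    also have "\<dots> = F u + F v" using False by (simp flip: Fmult)
    finally show ?thesis .
  qed (simp add: F0)
  then have "F s = s" for s using real_field_endomorphism_eq_id[of F s] Fmult F1 by blast
  then have "orth (x + s *\<^sub>R y + t *\<^sub>R z) (p *\<^sub>R x + q *\<^sub>R y + r *\<^sub>R z)
           \<longleftrightarrow> p + a * s * q + b * t * r = 0" for s t p q r
    using iff by (simp add: fF gF)
  then show ?thesis by blast
qed

section \<open>Construction of the scalar product\<close>

lemma frame_ordered_basis:
  assumes "frame x y z"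
  obtains e :: "3 \<Rightarrow> 'a" where "ordered_basis e" "e 1 = x" "e 2 = y" "e 3 = z"
proof -
  define e :: "3 \<Rightarrow> 'a" where "e i = (if i = 1 then x else if i = 2 then y else z)" for i
  have e: "e 1 = x" "e 2 = y" "e 3 = z" by (simp_all add: e_def)
  have r: "range e = {x, y, z}" by (auto simp: UNIV_3 e)
  have "card (range e) = card (UNIV :: 3 set)" using frame_basis(2)[OF assms] r by simp
  then have "inj e" by (simp add: eq_card_imp_inj_on)
  then have "ordered_basis e" using r frame_basis[OF assms] by (simp add: ordered_basis_def)
  then show ?thesis using that e by blast
qed

text \<open>The form is diagonal in a frame, with entries 1, \<alpha>, \<beta> from
  \<open>polar_coordinates\<close>. Since no nonzero vector is orthogonal to itself, the form has no
  null vectors, which forces \<alpha> and \<beta> to be positive.\<close>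

lemma ex_scalar_product: "\<exists>b\<in>scalar_products. \<forall>v w. orth v w \<longleftrightarrow> b v w = 0"
proof -
  obtain x :: 'a where "x \<noteq> 0" using ex_orth by blast
  then obtain y z where fr: "frame x y z" using ex_frame by blast
  obtain e :: "3 \<Rightarrow> 'a" where e: "ordered_basis e" "e 1 = x" "e 2 = y" "e 3 = z"
    using frame_ordered_basis[OF fr] .
  define p q r where "p v = coord e v 1" and "q v = coord e v 2" and "r v = coord e v 3" for v
  have lin: "linear p" "linear q" "linear r"
    unfolding p_def q_def r_def using linear_coord[OF e(1)] by auto
  have v: "v = p v *\<^sub>R x + q v *\<^sub>R y + r v *\<^sub>R z" for v
    using coord_sum[OF e(1), of v] by (simp add: sum_3 e p_def q_def r_def)
  have basis: "p x = 1" "q x = 0" "r x = 0" "p y = 0" "q y = 1" "r y = 0"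
    "p z = 0" "q z = 0" "r z = 1"
    using coord_basis[OF e(1), of 1] coord_basis[OF e(1), of 2] coord_basis[OF e(1), of 3]
    by (simp_all add: e p_def q_def r_def)
  obtain \<alpha> \<beta> where ab: "\<And>s t p q r. orth (x + s *\<^sub>R y + t *\<^sub>R z) (p *\<^sub>R x + q *\<^sub>R y + r *\<^sub>R z)
           \<longleftrightarrow> p + \<alpha> * s * q + \<beta> * t * r = 0"
    using polar_coordinates[OF fr] by blast
  define b where "b v w = p v * p w + \<alpha> * (q v * q w) + \<beta> * (r v * r w)" for v w
  have bil: "bilinear b"
    unfolding bilinear_def b_def using lin
    by (auto intro!: linearI simp: linear_add linear_scale algebra_simps)
  have bsym: "b v w = b w v" for v w by (simp add: b_def mult.commute)
  have 1: "orth v w \<longleftrightarrow> b v w = 0" if "p v \<noteq> 0" for v w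
  proof -
    have "p v *\<^sub>R (x + (q v / p v) *\<^sub>R y + (r v / p v) *\<^sub>R z) = v"
      using that by (simp add: scaleR_add_right flip: v)
    then have "orth v w \<longleftrightarrow> orth (x + (q v / p v) *\<^sub>R y + (r v / p v) *\<^sub>R z) w"
      using that scale_left_iff by metis
    also have "\<dots> \<longleftrightarrow> p w + \<alpha> * (q v / p v) * q w + \<beta> * (r v / p v) * r w = 0"
      using ab[of "q v / p v" "r v / p v" "p w" "q w" "r w"] by (simp flip: v)
    also have "\<dots> \<longleftrightarrow> b v w = 0"
      using that by (simp add: b_def field_simps)
    finally show ?thesis .
  qed
  have iff: "orth v w \<longleftrightarrow> b v w = 0" for v w
  proof (cases "p v = 0 \<and> p w = 0")
    case False
    then show ?thesis using 1[of v w] 1[of w v] sym_iff[of v w] bsym[of v w] by auto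
  next
    case True
    \<comment> \<open>Here \<open>w\<close> is orthogonal to \<open>x\<close>, so \<open>v\<close>
      may be replaced by \<open>v + x\<close>, whose first coordinate is 1.\<close>
    have "b x w = 0" using True basis by (simp add: b_def)
    then have xw: "orth x w" using 1[of x w] basis by simp
    have "orth v w \<longleftrightarrow> orth (v + x) w" using add_iff[OF sym[OF xw]] sym_iff by blast
    also have "\<dots> \<longleftrightarrow> b (v + x) w = 0"
      using 1[of "v + x" w] True basis by (simp add: linear_add[OF lin(1)])
    also have "\<dots> \<longleftrightarrow> b v w = 0"
      using \<open>b x w = 0\<close> bilinear_ladd[OF bil] by simp
    finally show ?thesis .
  qed
  have nz: "b v v \<noteq> 0" if "v \<noteq> 0" for v using iff[of v v] anisotropic that by blast
  \<comment> \<open>For negative \<open>c\<close> the value \<open>s = sqrt (- 1 / c)\<close> would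
    give a null vector.\<close>
  have pos: "c > 0" if "\<And>s. 1 + c * (s * s) \<noteq> 0" "c \<noteq> 0" for c :: real
  proof (rule ccontr)
    assume "\<not> c > 0"
    then have "c < 0" using that by simp
    then have "1 + c * (sqrt (- 1 / c) * sqrt (- 1 / c)) = 0"
      by (simp add: divide_nonneg_neg field_simps)
    then show False using that by blast
  qed
  have pa: "\<alpha> > 0"
  proof (rule pos)
    show "\<alpha> \<noteq> 0" using nz[of y] fr basis by (simp add: b_def frame_def)
    show "1 + \<alpha> * (s * s) \<noteq> 0" for s
    proof -
      have p: "p (x + s *\<^sub>R y) = 1" "q (x + s *\<^sub>R y) = s" "r (x + s *\<^sub>R y) = 0"
        using lin basis by (simp_all add: linear_add linear_scale)
      then have "x + s *\<^sub>R y \<noteq> 0" using lin linear_0 by fastforce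
      then show ?thesis using nz[of "x + s *\<^sub>R y"] p by (simp add: b_def)
    qed
  qed
  have pb: "\<beta> > 0"
  proof (rule pos)
    show "\<beta> \<noteq> 0" using nz[of z] fr basis by (simp add: b_def frame_def)
    show "1 + \<beta> * (s * s) \<noteq> 0" for s
    proof -
      have p: "p (x + s *\<^sub>R z) = 1" "q (x + s *\<^sub>R z) = 0" "r (x + s *\<^sub>R z) = s"
        using lin basis by (simp_all add: linear_add linear_scale)
      then have "x + s *\<^sub>R z \<noteq> 0" using lin linear_0 by fastforce
      then show ?thesis using nz[of "x + s *\<^sub>R z"] p by (simp add: b_def)
    qed
  qed
  have "b v v > 0" if "v \<noteq> 0" for v
  proof -
    have "b v v \<ge> 0" using pa pb by (simp add: b_def)
    then show ?thesis using nz[OF that] by simp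
  qed
  then have "b \<in> scalar_products" using bil bsym by (simp add: scalar_products_def)
  then show ?thesis using iff by blast
qed

end

subsection \<open>Half-turns of a scalar product\<close>

locale scalar_product_3 =
  fixes b :: "'a::real_vector \<Rightarrow> 'a \<Rightarrow> real"
  assumes dim3: "dim (UNIV :: 'a set) = 3" and sp: "b \<in> scalar_products"
begin

lemma bil: "bilinear b" and comm: "b x y = b y x" and pos: "x \<noteq> 0 \<Longrightarrow> b x x > 0"
  using sp by (auto simp: scalar_products_def)

lemmas simps = bilinear_ladd[OF bil] bilinear_radd[OF bil] bilinear_lmul[OF bil]
  bilinear_rmul[OF bil] bilinear_lsub[OF bil] bilinear_rsub[OF bil] bilinear_lneg[OF bil]
  bilinear_rneg[OF bil] bilinear_lzero[OF bil] bilinear_rzero[OF bil]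

lemma self_eq_0_iff [simp]: "b x x = 0 \<longleftrightarrow> x = 0"
  using pos[of x] by (cases "x = 0") (auto simp: simps)

text \<open>This makes frames and their completion available for \<open>b\<close>; the coefficient
  in \<open>projection\<close> is that of the orthogonal projection.\<close>

sublocale orthogonality "\<lambda>x y. b x y = 0"
proof
  show "\<exists>c. b x (y - c *\<^sub>R x) = 0" if "x \<noteq> 0" for x y
    by (rule exI[of _ "b x y / b x x"]) (simp add: simps that)
qed (auto simp: simps dim3 comm)

text \<open>Twice the orthogonal projection onto the line of \<open>x\<close>, minus the identity:
  the rotation by pi about that line.\<close>

definition half_turn :: "'a \<Rightarrow> 'a \<Rightarrow> 'a" where
  "half_turn x y = (2 * b x y / b x x) *\<^sub>R x - y"

lemma half_turn_self: "x \<noteq> 0 \<Longrightarrow> half_turn x x = x"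
  by (simp add: half_turn_def) (simp add: scaleR_2)

lemma half_turn_orth: "b x y = 0 \<Longrightarrow> half_turn x y = - y"
  by (simp add: half_turn_def)

lemma linear_half_turn: "linear (half_turn x)"
  by (rule linearI) (simp_all add: half_turn_def simps algebra_simps add_divide_distrib)

lemma half_turn_involution: "x \<noteq> 0 \<Longrightarrow> half_turn x (half_turn x y) = y"
  by (simp add: half_turn_def simps algebra_simps)

lemma half_turn_isometry: "x \<noteq> 0 \<Longrightarrow> b (half_turn x y) (half_turn x z) = b y z"
  by (simp add: half_turn_def simps comm[of y x] comm[of z x] field_simps)

lemma half_turn_GL: "x \<noteq> 0 \<Longrightarrow> half_turn x \<in> carrier GL"
  using linear_half_turn half_turn_involution
  by (auto simp: GL_def intro!: o_bij[of "half_turn x"])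

section \<open>Determinants and the group \<open>SO b\<close>\<close>

lemma endo_det_diagonal:
  assumes fr: "frame x y z" and f: "linear f" "f x = k *\<^sub>R x" "f y = l *\<^sub>R y" "f z = m *\<^sub>R z"
  shows "endo_det f = k * l * m"
proof -
  obtain e :: "3 \<Rightarrow> 'a" where e: "ordered_basis e" "e 1 = x" "e 2 = y" "e 3 = z"
    using frame_ordered_basis[OF fr] .
  have c: "coord e (a *\<^sub>R v) i = a * coord e v i" for a v i
    using linear_scale[OF linear_coord[OF e(1)]] by simp
  show ?thesis
    using coord_basis[OF e(1), of 1] coord_basis[OF e(1), of 2] coord_basis[OF e(1), of 3]
    by (simp add: endo_det_eq[OF e(1) f(1)] det_3 endo_matrix_def e f c)
qed

text \<open>In a frame beginning with \<open>x\<close> the half-turn is diagonal with entries 1, -1,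
  -1.\<close>

lemma half_turn_SO: "x \<noteq> 0 \<Longrightarrow> half_turn x \<in> SO b"
proof -
  assume x: "x \<noteq> 0"
  then obtain y z where fr: "frame x y z" using ex_frame by blast
  have "endo_det (half_turn x) = 1 * (- 1) * (- 1)"
    using fr by (intro endo_det_diagonal[OF fr linear_half_turn])
      (auto simp: half_turn_self half_turn_orth frame_def)
  then show ?thesis
    using x by (simp add: SO_def half_turn_GL half_turn_isometry)
qed

lemma endo_det_comp:
  assumes "linear f" "linear g"
  shows "endo_det (f \<circ> g) = endo_det f * endo_det (g :: 'a \<Rightarrow> 'a)"
proof -
  obtain e :: "3 \<Rightarrow> 'a" where e: "ordered_basis e" using ex_ordered_basis_3[OF dim3] by blast
  have "endo_matrix e (f \<circ> g) = endo_matrix e f ** endo_matrix e g"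
    using coord_expand[OF e e assms(1)]
    by (simp add: endo_matrix_def matrix_matrix_mult_def vec_eq_iff)
  then show ?thesis
    using assms by (simp add: endo_det_eq[OF e] linear_compose det_mul)
qed

lemma endo_det_id: "endo_det (id :: 'a \<Rightarrow> 'a) = 1"
proof -
  obtain e :: "3 \<Rightarrow> 'a" where e: "ordered_basis e" using ex_ordered_basis_3[OF dim3] by blast
  have "endo_matrix e id = mat 1"
    by (simp add: endo_matrix_def mat_def coord_basis[OF e] vec_eq_iff)
  then show ?thesis by (simp add: endo_det_eq[OF e linear_id])
qed

lemma SO_comp: "f \<in> SO b \<Longrightarrow> g \<in> SO b \<Longrightarrow> f \<circ> g \<in> SO b"
  by (auto simp: SO_def GL_def endo_det_comp linear_compose bij_comp)

lemma SO_subgroup: "subgroup (SO b) GL"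
proof (rule group.subgroupI[OF group_GL])
  show "SO b \<subseteq> carrier GL" by (auto simp: SO_def)
  have "id \<in> SO b" by (simp add: SO_def GL_def linear_id endo_det_id)
  then show "SO b \<noteq> {}" by blast
  show "f \<otimes>\<^bsub>GL\<^esub> g \<in> SO b" if "f \<in> SO b" "g \<in> SO b" for f g
    using SO_comp that by (simp add: GL_def)
  fix f assume f: "f \<in> SO b"
  then have fG: "f \<in> carrier GL" by (simp add: SO_def)
  define g where "g = inv\<^bsub>GL\<^esub> f"
  have gG: "g \<in> carrier GL" using group.inv_closed[OF group_GL fG] by (simp add: g_def)
  have "f \<otimes>\<^bsub>GL\<^esub> g = \<one>\<^bsub>GL\<^esub>" using group.r_inv[OF group_GL fG] by (simp add: g_def)
  then have fg: "f \<circ> g = id" by (simp add: GL_def)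
  then have fgx: "f (g x) = x" for x by (metis comp_apply id_apply)
  have "b (g v) (g w) = b v w" for v w
  proof -
    have "b (f (g v)) (f (g w)) = b (g v) (g w)" using f by (simp add: SO_def)
    then show ?thesis by (simp add: fgx)
  qed
  moreover have "endo_det f * endo_det g = 1"
    using endo_det_comp[of f g] fG gG fg endo_det_id by (simp add: GL_def)
  ultimately show "inv\<^bsub>GL\<^esub> f \<in> SO b"
    using f gG by (simp add: SO_def flip: g_def)
qed

text \<open>The vector \<open>u\<close> completing \<open>v\<close> and \<open>w\<close> to a frame
  must go to a multiple of itself, and determinant 1 makes the factor 1.\<close>

lemma SO_fix_orthogonal:
  assumes g: "g \<in> SO b" and v: "v \<noteq> 0" "w \<noteq> 0" "b v w = 0" "g v = v" "g w = w"
  shows "g = id"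
proof -
  have lin: "linear g" and bg: "b (g x) (g y) = b x y" and det: "endo_det g = 1" for x y
    using g by (auto simp: SO_def GL_def)
  obtain u where u: "u \<noteq> 0" "b v u = 0" "b w u = 0" using ex_orth_pair[of v w] v by blast
  have fr: "frame u v w" using u v comm by (simp add: frame_def)
  have "b v (g u) = 0" "b w (g u) = 0" using bg[of v u] bg[of w u] u v by simp_all
  moreover obtain k l m where k: "g u = k *\<^sub>R u + l *\<^sub>R v + m *\<^sub>R w"
    using frame_expand[OF fr] .
  ultimately have "l = 0" "m = 0" using u v comm[of w v] by (simp_all add: simps)
  then have gu: "g u = k *\<^sub>R u" using k by simp
  then have "k = 1" using endo_det_diagonal[OF fr lin gu, of 1 1] v det by simp
  then have "g u = u" using gu by simp
  show ?thesis
  proof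
    fix x
    obtain k l m where "x = k *\<^sub>R u + l *\<^sub>R v + m *\<^sub>R w" using frame_expand[OF fr] .
    then show "g x = id x" using \<open>g u = u\<close> v lin by (simp add: linear_add linear_scale)
  qed
qed

section \<open>Transitivity of the half-turns\<close>

lemma half_turn_add:
  assumes "b v v = b w w" "v + w \<noteq> 0"
  shows "half_turn (v + w) v = w"
proof -
  \<comment> \<open>As \<open>v\<close> and \<open>w\<close> have equal length, \<open>v + w\<close>
    spans their bisector and the projection of \<open>v\<close> onto it is half of
    \<open>v + w\<close>.\<close>
  have *: "b (v + w) (v + w) = 2 * b (v + w) v"
    using assms(1) by (simp add: simps comm[of w v])
  moreover have "b (v + w) (v + w) \<noteq> 0" using assms(2) by simp
  ultimately show ?thesis by (simp add: half_turn_def)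
qed

text \<open>One half-turn takes \<open>v\<close> to \<open>v'\<close>. The image \<open>u\<close> of
  \<open>w\<close> is then moved to \<open>w'\<close> with \<open>v'\<close> kept fixed, by the
  half-turns about \<open>u + w'\<close> and \<open>w'\<close>: each of them negates
  \<open>v'\<close>. The antipodal cases need other axes. The set \<open>G\<close> is arbitrary so
  that it can be \<open>SO b\<close> or its intersection with a given rotation group.\<close>

lemma half_turns_transitive:
  assumes closed: "\<And>f g. f \<in> G \<Longrightarrow> g \<in> G \<Longrightarrow> f \<circ> g \<in> G"
    and half: "\<And>x. x \<noteq> 0 \<Longrightarrow> half_turn x \<in> G"
    and v: "b v v = 1" "b w w = 1" "b v w = 0"
    and v': "b v' v' = 1" "b w' w' = 1" "b v' w' = 0"
  shows "\<exists>g\<in>G. g v = v' \<and> g w = w'"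
proof -
  have ne: "v \<noteq> 0" "w \<noteq> 0" "v' \<noteq> 0" "w' \<noteq> 0"
    using v v' self_eq_0_iff by (metis zero_neq_one)+
  have "\<exists>x. x \<noteq> 0 \<and> half_turn x v = v'"
  proof (cases "v + v' = 0")
    case True
    then have "v' = - v" by (simp add: eq_neg_iff_add_eq_0 add.commute)
    then have "half_turn w v = v'" using half_turn_orth[of w v] v comm[of w v] by simp
    then show ?thesis using ne by blast
  next
    case False
    then show ?thesis using half_turn_add[of v v'] v v' by metis
  qed
  then obtain x where x: "x \<noteq> 0" "half_turn x v = v'" by blast
  define u where "u = half_turn x w"
  have u: "b u u = 1" "b v' u = 0"
    using half_turn_isometry[OF x(1), of w w] half_turn_isometry[OF x(1), of v w] v x
    by (simp_all add: u_def)
  have "\<exists>g\<in>G. g v' = v' \<and> g u = w'"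
  proof (cases "u + w' = 0")
    case True
    then have "w' = - u" by (simp add: eq_neg_iff_add_eq_0 add.commute)
    then have "half_turn v' v' = v' \<and> half_turn v' u = w'"
      using half_turn_self half_turn_orth ne u by simp
    then show ?thesis using half ne by blast
  next
    case False
    let ?g = "half_turn w' \<circ> half_turn (u + w')"
    have "half_turn (u + w') v' = - v'"
      using u v' by (intro half_turn_orth) (simp add: simps comm[of u v'] comm[of w' v'])
    moreover have "half_turn w' (- v') = v'"
      using v' half_turn_orth[of w' "- v'"] by (simp add: simps comm[of w' v'])
    moreover have "half_turn (u + w') u = w'" using half_turn_add[of u w'] u v' False by simp
    ultimately have "?g v' = v' \<and> ?g u = w'" using half_turn_self ne by simp
    moreover have "?g \<in> G" using closed half ne False by blast
    ultimately show ?thesis by blast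
  qed
  then obtain g where g: "g \<in> G" "g v' = v'" "g u = w'" by blast
  have "g \<circ> half_turn x \<in> G" using closed half g x by blast
  then show ?thesis using g x by (intro bexI[of _ "g \<circ> half_turn x"]) (simp_all add: u_def)
qed

end

subsection \<open>Flags\<close>

lemma eq_uminus_imp_0:
  fixes x :: "'a::real_vector"
  assumes "x = - x"
  shows "x = 0"
proof -
  have "2 *\<^sub>R x = 0" using assms by (simp add: scaleR_2 eq_neg_iff_add_eq_0)
  then show ?thesis by simp
qed

text \<open>No independence is demanded of \<open>v\<close> and \<open>w\<close>, so that images
  under all linear maps keep this form.\<close>

definition half_plane :: "'a::real_vector \<Rightarrow> 'a \<Rightarrow> 'a set" where
  "half_plane v w = {s *\<^sub>R v + t *\<^sub>R w | s t. t \<ge> 0}"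

definition ray :: "'a::real_vector \<Rightarrow> 'a set" where
  "ray v = {t *\<^sub>R v | t. t \<ge> 0}"

lemma half_plane_image: "linear d \<Longrightarrow> d ` half_plane v w = half_plane (d v) (d w)"
  by (force simp: half_plane_def linear_add linear_scale)

lemma ray_image: "linear d \<Longrightarrow> d ` ray v = ray (d v)"
  by (force simp: ray_def linear_scale)

lemma ray_rescale:
  assumes "k > 0"
  shows "ray (k *\<^sub>R v) = ray v"
proof -
  have "t *\<^sub>R v \<in> ray (k *\<^sub>R v)" if "t \<ge> 0" for t
    unfolding ray_def using that assms by (auto intro!: exI[of _ "t / k"])
  moreover have "t *\<^sub>R (k *\<^sub>R v) \<in> ray v" if "t \<ge> 0" for t
    unfolding ray_def using that assms by (auto intro!: exI[of _ "t * k"])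
  ultimately show ?thesis unfolding ray_def by blast
qed

text \<open>This is the freedom in choosing the spanning vectors; \<open>flag_eqD\<close> is the
  converse, where the ray also fixes the sign of \<open>k\<close>.\<close>

lemma half_plane_rescale:
  assumes "k \<noteq> 0" "m > 0"
  shows "half_plane (k *\<^sub>R v) (m *\<^sub>R w + c *\<^sub>R v) = half_plane v w"
proof -
  have "s *\<^sub>R v + t *\<^sub>R w \<in> half_plane (k *\<^sub>R v) (m *\<^sub>R w + c *\<^sub>R v)" if "t \<ge> 0" for s t
  proof -
    have "s *\<^sub>R v + t *\<^sub>R w =
        ((s - t / m * c) / k) *\<^sub>R (k *\<^sub>R v) + (t / m) *\<^sub>R (m *\<^sub>R w + c *\<^sub>R v)"
      using assms by (simp add: scaleR_add_right scaleR_diff_left)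
    then show ?thesis using that assms unfolding half_plane_def by fastforce
  qed
  moreover have "s *\<^sub>R (k *\<^sub>R v) + t *\<^sub>R (m *\<^sub>R w + c *\<^sub>R v) \<in> half_plane v w" if "t \<ge> 0" for s t
  proof -
    have "s *\<^sub>R (k *\<^sub>R v) + t *\<^sub>R (m *\<^sub>R w + c *\<^sub>R v) = (s * k + t * c) *\<^sub>R v + (t * m) *\<^sub>R w"
      by (simp add: algebra_simps)
    moreover have "t * m \<ge> 0" using that assms by simp
    ultimately show ?thesis unfolding half_plane_def by blast
  qed
  ultimately show ?thesis unfolding half_plane_def by blast
qed

text \<open>The generator of the ray is a multiple, perhaps negative, of the boundary vector, and
  may replace it as a spanning vector of the half-plane.\<close>

lemma is_flag_iff:
  "is_flag H L \<longleftrightarrow> (\<exists>v w. v \<noteq> 0 \<and> w \<notin> span {v} \<and> H = half_plane v w \<and> L = ray v)"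
proof
  assume "is_flag H L"
  then obtain v w u where vw: "v \<noteq> w" "independent {v, w}" "H = half_plane v w"
    and u: "u \<noteq> 0" "L = ray u" "L \<subseteq> boundary_line H"
    by (auto simp: is_flag_def is_half_plane_def is_ray_def half_plane_def ray_def)
  have b: "boundary_line H = span {v}"
    using boundary_line_half_plane[OF vw(1,2)] vw(3) by (simp add: half_plane_def)
  have "u \<in> L" unfolding u(2) ray_def by (auto intro!: exI[of _ 1])
  then obtain k where k: "u = k *\<^sub>R v" using b u(3) by (auto simp: span_singleton)
  then have "k \<noteq> 0" using u by auto
  have wv: "w \<notin> span {v}"
    using vw real_vector.independent_insert[of w "{v}"] by (auto simp: insert_commute)
  have "w \<notin> span {u}" using wv k by (auto simp: span_singleton)
  moreover have "H = half_plane u w"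
    using half_plane_rescale[OF \<open>k \<noteq> 0\<close>, of 1 v w 0] k vw by simp
  ultimately show "\<exists>v w. v \<noteq> 0 \<and> w \<notin> span {v} \<and> H = half_plane v w \<and> L = ray v"
    using u by blast
next
  assume "\<exists>v w. v \<noteq> 0 \<and> w \<notin> span {v} \<and> H = half_plane v w \<and> L = ray v"
  then obtain v w where v: "v \<noteq> 0" "w \<notin> span {v}" "H = half_plane v w" "L = ray v" by blast
  have ne: "v \<noteq> w" using v span_base by blast
  have ind: "independent {v, w}"
    using v ne real_vector.independent_insert[of w "{v}"] by (simp add: insert_commute)
  have "boundary_line H = span {v}"
    using boundary_line_half_plane[OF ne ind] v by (simp add: half_plane_def)
  moreover have "ray v \<subseteq> span {v}" by (auto simp: ray_def span_singleton)
  ultimately show "is_flag H L"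
    using v ne ind by (auto simp: is_flag_def is_half_plane_def is_ray_def half_plane_def ray_def)
qed

lemma flag_eqD:
  assumes "v' \<noteq> 0" "w' \<notin> span {v'}" "ray v' = ray v" "half_plane v' w' = half_plane v w"
  obtains k m c where "k > 0" "m > 0" "v' = k *\<^sub>R v" "w' = m *\<^sub>R w + c *\<^sub>R v"
proof -
  have "v' = 1 *\<^sub>R v'" by simp
  then have "v' \<in> ray v'" unfolding ray_def using zero_le_one by blast
  then have "v' \<in> ray v" using assms(3) by simp
  then obtain k where k: "k \<ge> 0" "v' = k *\<^sub>R v" by (auto simp: ray_def)
  then have k0: "k > 0" using assms(1) by (cases "k = 0") auto
  have "w' = 0 *\<^sub>R v' + 1 *\<^sub>R w'" by simp
  then have "w' \<in> half_plane v' w'" unfolding half_plane_def using zero_le_one by blast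
  then have "w' \<in> half_plane v w" using assms(4) by simp
  then obtain c m where m: "m \<ge> 0" "w' = c *\<^sub>R v + m *\<^sub>R w"
    by (auto simp: half_plane_def)
  have "m \<noteq> 0"
  proof
    assume "m = 0"
    then have "w' = (c / k) *\<^sub>R v'" using m k k0 by simp
    then show False using assms(2) by (auto simp: span_singleton)
  qed
  then show ?thesis using that[of k m c] k k0 m by (simp add: add.commute)
qed

section \<open>The action of \<open>SO b\<close> on flags\<close>

context scalar_product_3
begin

text \<open>Gram-Schmidt with positive normalizing factors changes neither the ray nor the
  half-plane.\<close>

lemma flag_orthonormal:
  assumes "is_flag H L"
  obtains v w where "b v v = 1" "b w w = 1" "b v w = 0" "H = half_plane v w" "L = ray v"
proof -
  obtain v w where v: "v \<noteq> 0" "w \<notin> span {v}" "H = half_plane v w" "L = ray v"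
    using assms unfolding is_flag_iff by blast
  define a where "a = b v w / b v v"
  define u where "u = w - a *\<^sub>R v"
  have u: "u \<noteq> 0" using v(2) by (auto simp: u_def span_singleton)
  have vu: "b v u = 0" using v(1) by (simp add: u_def a_def simps)
  define k where "k = inverse (sqrt (b v v))"
  define m where "m = inverse (sqrt (b u u))"
  have km: "k > 0" "m > 0" using pos[OF v(1)] pos[OF u] by (simp_all add: k_def m_def)
  have "k * k = inverse (b v v)" "m * m = inverse (b u u)"
    using pos[OF v(1)] pos[OF u] by (simp_all add: k_def m_def flip: inverse_mult_distrib)
  then have kk: "k * k * b v v = 1" and mm: "m * m * b u u = 1"
    using v(1) u by simp_all
  show ?thesis
  proof (rule that)
    show "b (k *\<^sub>R v) (k *\<^sub>R v) = 1" "b (m *\<^sub>R u) (m *\<^sub>R u) = 1" "b (k *\<^sub>R v) (m *\<^sub>R u) = 0"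
      using kk mm vu by (simp_all add: simps mult.assoc)
    have "m *\<^sub>R u = m *\<^sub>R w + (- (m * a)) *\<^sub>R v" by (simp add: u_def scaleR_diff_right)
    then show "H = half_plane (k *\<^sub>R v) (m *\<^sub>R u)"
      using half_plane_rescale[of k m v w "- (m * a)"] km v(3) by simp
    show "L = ray (k *\<^sub>R v)" by (rule trans[OF v(4) ray_rescale[OF km(1), symmetric]])
  qed
qed

lemma half_turns_transitive_flags:
  assumes "\<And>f g. f \<in> G \<Longrightarrow> g \<in> G \<Longrightarrow> f \<circ> g \<in> G" "\<And>x. x \<noteq> 0 \<Longrightarrow> half_turn x \<in> G"
    and G: "\<And>g. g \<in> G \<Longrightarrow> linear g" and flags: "is_flag H L" "is_flag H' L'"
  obtains g where "g \<in> G" "g ` H = H'" "g ` L = L'"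
proof -
  obtain v w where v: "b v v = 1" "b w w = 1" "b v w = 0" "H = half_plane v w" "L = ray v"
    using flag_orthonormal[OF flags(1)] .
  obtain v' w' where v': "b v' v' = 1" "b w' w' = 1" "b v' w' = 0" "H' = half_plane v' w'" "L' = ray v'"
    using flag_orthonormal[OF flags(2)] .
  obtain g where "g \<in> G" "g v = v'" "g w = w'"
    using half_turns_transitive[of G, OF assms(1,2) v(1-3) v'(1-3)] by blast
  then show ?thesis using that[of g] G v v' by (simp add: half_plane_image ray_image)
qed

lemma SO_linear: "g \<in> SO b \<Longrightarrow> linear g"
  by (simp add: SO_def GL_def)

lemma SO_isometry: "g \<in> SO b \<Longrightarrow> b (g x) (g y) = b x y"
  by (simp add: SO_def)

text \<open>On orthonormal generators of the flag \<open>g\<close> is triangular with positive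
  diagonal entries; being an isometry, it fixes both generators.\<close>

lemma SO_fix_flag:
  assumes g: "g \<in> SO b" and flag: "is_flag H L" "g ` H = H" "g ` L = L"
  shows "g = id"
proof -
  obtain v w where v: "b v v = 1" "b w w = 1" "b v w = 0" "H = half_plane v w" "L = ray v"
    using flag_orthonormal[OF flag(1)] .
  have nz: "v \<noteq> 0" "w \<noteq> 0" using v self_eq_0_iff by (metis zero_neq_one)+
  note iso = SO_isometry[OF g]
  have gv: "g v \<noteq> 0" using iso[of v v] v by (auto simp: simps)
  have gw: "g w \<notin> span {g v}"
  proof
    assume "g w \<in> span {g v}"
    then obtain a where a: "g w = a *\<^sub>R g v" by (auto simp: span_singleton)
    then have "a = 0" using iso[of v w] iso[of v v] v by (simp add: simps)
    then show False using a iso[of w w] v by (simp add: simps)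
  qed
  have "ray (g v) = ray v" "half_plane (g v) (g w) = half_plane v w"
    using flag v SO_linear[OF g] by (simp_all add: ray_image half_plane_image)
  then obtain k m c where k: "k > 0" "m > 0" "g v = k *\<^sub>R v" "g w = m *\<^sub>R w + c *\<^sub>R v"
    using flag_eqD[OF gv gw] by blast
  have wv: "b w v = 0" using v comm[of w v] by simp
  have "k * k = 1" using iso[of v v] k v by (simp add: simps)
  then have "k = 1" using k(1) by (metis abs_of_pos real_sqrt_abs2 real_sqrt_one)
  moreover have "c = 0" using iso[of v w] k v by (simp add: simps)
  moreover have "m = 1"
  proof -
    have "m * m = 1" using iso[of w w] k v \<open>c = 0\<close> by (simp add: simps)
    then show ?thesis using k(2) by (metis abs_of_pos real_sqrt_abs2 real_sqrt_one)
  qed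
  ultimately show ?thesis using SO_fix_orthogonal[OF g nz v(3)] k by simp
qed

lemma SO_flag_unique:
  assumes "d \<in> SO b" "e \<in> SO b" "is_flag H L" "d ` H = e ` H" "d ` L = e ` L"
  shows "d = e"
proof -
  have dG: "d \<in> carrier GL" using assms(1) by (simp add: SO_def)
  define i where "i = inv\<^bsub>GL\<^esub> d"
  have i: "i \<in> SO b" using subgroup.m_inv_closed[OF SO_subgroup assms(1)] by (simp add: i_def)
  have id: "i \<circ> d = id" "d \<circ> i = id"
    using group.l_inv[OF group_GL dG] group.r_inv[OF group_GL dG] by (simp_all add: i_def GL_def)
  have "(i \<circ> e) ` H = (i \<circ> d) ` H" "(i \<circ> e) ` L = (i \<circ> d) ` L"
    using assms(4,5) by (simp_all only: image_comp[symmetric])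
  then have "i \<circ> e = id" using SO_fix_flag[OF SO_comp[OF i assms(2)] assms(3)] id by simp
  then have "d \<circ> (i \<circ> e) = d" by simp
  then show ?thesis using id by (simp flip: comp_assoc)
qed

lemma rotation_group_SO: "rotation_group (SO b)"
  unfolding rotation_group_def
proof (intro conjI allI impI)
  fix H L H' L' :: "'a set" assume flags: "is_flag H L" "is_flag H' L'"
  obtain g where g: "g \<in> SO b" "g ` H = H'" "g ` L = L'"
    using half_turns_transitive_flags[of "SO b", OF SO_comp half_turn_SO SO_linear flags] .
  show "\<exists>!d. d \<in> SO b \<and> d ` H = H' \<and> d ` L = L'"
  proof (rule ex1I[of _ g])
    show "d = g" if "d \<in> SO b \<and> d ` H = H' \<and> d ` L = L'" for d
      by (rule SO_flag_unique[OF _ g(1) flags(1)]) (simp_all add: that g)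
  qed (simp add: g)
qed (rule SO_subgroup)

section \<open>Recovering a scalar product up to scaling\<close>

lemma proportional_if_orth:
  assumes b': "b' \<in> scalar_products" and orth: "\<And>x y. b x y = 0 \<Longrightarrow> b' x y = 0"
  shows "(b, b') \<in> positive_multiple"
proof -
  interpret b': scalar_product_3 b' by unfold_locales (use dim3 b' in auto)
  define l where "l x = b' x x / b x x" for x
  \<comment> \<open>The component of \<open>y\<close> orthogonal to \<open>x\<close> contributes to
    neither form. By symmetry the factor \<open>l\<close> then agrees on any two vectors that are
    not orthogonal.\<close>
  have *: "b' x y = l x * b x y" if "x \<noteq> 0" for x y
  proof -
    have "b' x (y - (b x y / b x x) *\<^sub>R x) = 0"
      using that by (intro orth) (simp add: simps)
    then show ?thesis by (simp add: b'.simps l_def)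
  qed
  have eq: "l x = l y" if "x \<noteq> 0" "b x y \<noteq> 0" for x y
  proof -
    have "y \<noteq> 0" using that by (auto simp: simps)
    then show ?thesis using *[of x y] *[of y x] that comm[of x y] b'.comm[of x y] by simp
  qed
  obtain x\<^sub>0 :: 'a where x0: "x\<^sub>0 \<noteq> 0" using ex_orth by blast
  have const: "l y = l x\<^sub>0" if "y \<noteq> 0" for y
  proof (cases "b x\<^sub>0 y = 0")
    case True
    \<comment> \<open>Orthogonal vectors are compared through their sum, which is orthogonal to
      neither.\<close>
    have 1: "b x\<^sub>0 (x\<^sub>0 + y) \<noteq> 0" and 2: "b y (x\<^sub>0 + y) \<noteq> 0"
      using True that x0 comm[of y x\<^sub>0] by (simp_all add: simps)
    show ?thesis using eq[OF x0 1] eq[OF that 2] by simp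
  next
    case False
    then show ?thesis using eq[OF x0 False] by simp
  qed
  have "b' = (\<lambda>v w. l x\<^sub>0 * b v w)"
  proof (intro ext)
    fix v w show "b' v w = l x\<^sub>0 * b v w"
      using *[of v w] const[of v] by (cases "v = 0") (simp_all add: simps b'.simps)
  qed
  moreover have "l x\<^sub>0 > 0" using pos[OF x0] b'.pos[OF x0] by (simp add: l_def)
  ultimately show ?thesis using sp b' by (auto simp: positive_multiple_def)
qed

text \<open>The half-turn of \<open>b\<close> about \<open>x\<close> preserves \<open>b'\<close>,
  fixes \<open>x\<close> and negates \<open>y\<close>, so \<open>b' x y\<close> equals its own
  negative.\<close>

lemma SO_inj:
  assumes b': "b' \<in> scalar_products" and eq: "SO b = SO b'"
  shows "(b, b') \<in> positive_multiple"
proof (rule proportional_if_orth[OF b'])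
  interpret b': scalar_product_3 b' by unfold_locales (use dim3 b' in auto)
  fix x y assume "b x y = 0"
  show "b' x y = 0"
  proof (cases "x = 0")
    case False
    then have "half_turn x \<in> SO b'" using half_turn_SO eq by simp
    then have "b' (half_turn x x) (half_turn x y) = b' x y" by (rule b'.SO_isometry)
    then show ?thesis using half_turn_self[OF False] half_turn_orth[OF \<open>b x y = 0\<close>]
      by (simp add: b'.simps)
  qed (simp add: b'.simps)
qed

end

lemma SO_scale:
  assumes "c > 0"
  shows "SO (\<lambda>v w. c * b v w) = SO b"
  using assms by (simp add: SO_def)

subsection \<open>Half-turns in a rotation group\<close>

locale rotation_group_3 =
  fixes D :: "('a::real_vector \<Rightarrow> 'a) set"
  assumes dim3: "dim (UNIV :: 'a set) = 3" and rot: "rotation_group D"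
begin

lemma linear: "d \<in> D \<Longrightarrow> linear d" and inj: "d \<in> D \<Longrightarrow> inj d"
  using rot subgroup.subset[of D GL] by (auto simp: rotation_group_def GL_def bij_def)

lemma comp: "d \<in> D \<Longrightarrow> e \<in> D \<Longrightarrow> d \<circ> e \<in> D"
  using rot subgroup.m_closed[of D GL d e] by (simp add: rotation_group_def GL_def)

lemma id: "id \<in> D"
  using rot subgroup.one_closed[of D GL] by (simp add: rotation_group_def GL_def)

lemma flag_ex1:
  "is_flag H L \<Longrightarrow> is_flag H' L' \<Longrightarrow> \<exists>!d. d \<in> D \<and> d ` H = H' \<and> d ` L = L'"
  using rot by (simp add: rotation_group_def)

lemma flag_unique:
  assumes "is_flag H L" "is_flag H' L'" "d \<in> D" "d ` H = H'" "d ` L = L'"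
    and "e \<in> D" "e ` H = H'" "e ` L = L'"
  shows "d = e"
  using flag_ex1[OF assms(1,2)] assms(3-8) by (elim ex1E) metis

text \<open>The two equations say that \<open>d\<close> preserves the flag generated by
  \<open>v\<close> and \<open>w\<close>, just as \<open>id\<close> does. This is the form in which
  the uniqueness in the definition gets used below.\<close>

lemma eq_id_if_fix_flag:
  assumes d: "d \<in> D" and v: "v \<noteq> 0" "w \<notin> span {v}"
    and "k > 0" "m > 0" "d v = k *\<^sub>R v" "d w = m *\<^sub>R w + c *\<^sub>R v"
  shows "d = id"
proof -
  have flag: "is_flag (half_plane v w) (ray v)" using v unfolding is_flag_iff by blast
  have "d ` half_plane v w = half_plane v w" "d ` ray v = ray v"
    using assms half_plane_rescale[of k m v w c] ray_rescale[of k v] linear[OF d]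
    by (simp_all add: half_plane_image ray_image)
  then show ?thesis by (intro flag_unique[OF flag flag d _ _ id]) simp_all
qed

text \<open>The half-planes on the two sides of the line of \<open>v\<close> form flags with the
  same ray; \<open>flag_eqD\<close> turns the map between these flags into equations.\<close>

lemma ex_flip:
  assumes v: "v \<noteq> 0" "w \<notin> span {v}"
  obtains d k m c where "d \<in> D" "k > 0" "m > 0" "d v = k *\<^sub>R v" "d w = m *\<^sub>R (- w) + c *\<^sub>R v"
proof -
  have "- w \<notin> span {v}" using v span_neg by fastforce
  then have "is_flag (half_plane v w) (ray v)" "is_flag (half_plane v (- w)) (ray v)"
    using v unfolding is_flag_iff by blast+
  then obtain d where d: "d \<in> D" "d ` half_plane v w = half_plane v (- w)" "d ` ray v = ray v"
    using flag_ex1 by blast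
  note l = linear[OF d(1)]
  have dv: "d v \<noteq> 0" using inj[OF d(1)] v linear_0[OF l] by (metis injD)
  have dw: "d w \<notin> span {d v}"
  proof
    assume "d w \<in> span {d v}"
    then obtain a where "d w = d (a *\<^sub>R v)" using l by (auto simp: span_singleton linear_scale)
    then have "w = a *\<^sub>R v" using inj[OF d(1)] by (simp add: inj_eq)
    then show False using v by (auto simp: span_singleton)
  qed
  have "ray (d v) = ray v" "half_plane (d v) (d w) = half_plane v (- w)"
    using d l by (simp_all add: half_plane_image ray_image)
  then obtain k m c where "k > 0" "m > 0" "d v = k *\<^sub>R v" "d w = m *\<^sub>R (- w) + c *\<^sub>R v"
    by (rule flag_eqD[OF dv dw])
  then show ?thesis by (rule that[OF d(1)])
qed

section \<open>Existence and uniqueness of half-turns\<close>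

definition is_half_turn :: "('a \<Rightarrow> 'a) \<Rightarrow> 'a \<Rightarrow> bool" where
  "is_half_turn d v \<longleftrightarrow> d \<in> D \<and> d v = v \<and> (\<forall>x. d (d x) = x) \<and> d \<noteq> id"

lemma ex_half_turn:
  assumes v: "v \<noteq> 0"
  shows "\<exists>d. is_half_turn d v"
proof -
  obtain w where w: "w \<notin> span {v}" using ex_notin_span_pair[OF dim3, of v v] by auto
  obtain d k m c where d: "d \<in> D" "k > 0" "m > 0" "d v = k *\<^sub>R v" "d w = m *\<^sub>R (- w) + c *\<^sub>R v"
    using ex_flip[OF v w] .
  note l = linear[OF d(1)]
  have ddv: "(d \<circ> d) v = (k * k) *\<^sub>R v" using d l by (simp add: linear_scale)
  have "(d \<circ> d) w = m *\<^sub>R (- (m *\<^sub>R (- w) + c *\<^sub>R v)) + c *\<^sub>R (k *\<^sub>R v)"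
    using d l by (simp add: linear_add linear_diff linear_neg linear_scale)
  then have ddw: "(d \<circ> d) w = (m * m) *\<^sub>R w + (c * k - m * c) *\<^sub>R v" by (simp add: algebra_simps)
  \<comment> \<open>The square is triangular with positive diagonal entries \<open>k * k\<close> and
    \<open>m * m\<close>, so it fixes the original flag.\<close>
  have dd: "d \<circ> d = id"
    using d by (intro eq_id_if_fix_flag[OF comp[OF d(1) d(1)] v w _ _ ddv ddw]) simp_all
  have "(k * k) *\<^sub>R v = 1 *\<^sub>R v" using ddv dd by simp
  then have "k * k = 1" using v by (metis scaleR_right_imp_eq)
  then have "k = 1" using d(2) by (metis abs_of_pos real_sqrt_abs2 real_sqrt_one)
  moreover have "d \<noteq> id"
  proof
    assume "d = id"
    then have "(1 + m) *\<^sub>R w = c *\<^sub>R v" using d(5) by (simp add: algebra_simps)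
    then have "inverse (1 + m) *\<^sub>R ((1 + m) *\<^sub>R w) = inverse (1 + m) *\<^sub>R (c *\<^sub>R v)" by simp
    then have "w = (inverse (1 + m) * c) *\<^sub>R v" using d(3) by simp
    then show False using w by (auto simp: span_singleton)
  qed
  moreover have "d (d x) = x" for x using dd by (metis comp_apply id_apply)
  ultimately show ?thesis
    unfolding is_half_turn_def using d(1,4) by (intro exI[of _ d]) simp
qed

text \<open>A fixed vector off the line of \<open>v\<close> would span, together with
  \<open>v\<close>, a fixed flag.\<close>

lemma half_turn_axis:
  assumes d: "is_half_turn d v" and v: "v \<noteq> 0" and "d x = x"
  shows "x \<in> span {v}"
proof (rule ccontr)
  assume "x \<notin> span {v}"
  then have "d = id"
    using eq_id_if_fix_flag[of d v x 1 1 0] assms by (simp add: is_half_turn_def)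
  then show False using d by (simp add: is_half_turn_def)
qed

text \<open>The sum \<open>x + d x\<close> is fixed by the involution, hence lies on the axis. Thus
  \<open>d\<close> acts as -1 modulo its axis.\<close>

lemma half_turn_add_self:
  assumes d: "is_half_turn d v" and v: "v \<noteq> 0"
  obtains a where "d x = a *\<^sub>R v - x"
proof -
  have "d (x + d x) = x + d x" using d linear by (simp add: is_half_turn_def linear_add)
  then obtain a where "x + d x = a *\<^sub>R v" using half_turn_axis[OF d v] by (auto simp: span_singleton)
  then have "d x = a *\<^sub>R v - x" by (simp add: algebra_simps)
  then show ?thesis by (rule that)
qed

text \<open>Both maps act as -1 modulo the axis, so their product fixes \<open>v\<close> and changes
  \<open>w\<close> only by a multiple of \<open>v\<close>; such a map fixes a flag.\<close>

lemma half_turn_unique: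
  assumes d: "is_half_turn d v" and e: "is_half_turn e v" and v: "v \<noteq> 0"
  shows "d = e"
proof -
  have dD: "d \<in> D" "e \<in> D" "d v = v" "e v = v" using d e by (auto simp: is_half_turn_def)
  obtain w where w: "w \<notin> span {v}" using ex_notin_span_pair[OF dim3, of v v] by auto
  obtain a where a: "d w = a *\<^sub>R v - w" using half_turn_add_self[OF d v] .
  obtain c where c: "e w = c *\<^sub>R v - w" using half_turn_add_self[OF e v] .
  have "(d \<circ> e) w = 1 *\<^sub>R w + (c - a) *\<^sub>R v"
    using a c dD linear[OF dD(1)] by (simp add: linear_diff linear_scale scaleR_diff_left)
  moreover have "(d \<circ> e) v = 1 *\<^sub>R v" using dD by simp
  ultimately have "d \<circ> e = id"
    by (intro eq_id_if_fix_flag[OF comp[OF dD(1,2)] v w zero_less_one zero_less_one])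
  then have "d (e x) = x" for x by (metis comp_apply id_apply)
  then have "e x = d x" for x using d unfolding is_half_turn_def by metis
  then show ?thesis by auto
qed

text \<open>For \<open>x = 0\<close> the predicate \<open>is_half_turn\<close> does not single out a
  map, so 0 is declared orthogonal to everything, as for a scalar product.\<close>

definition orth :: "'a \<Rightarrow> 'a \<Rightarrow> bool" where
  "orth x y \<longleftrightarrow> x = 0 \<or> (\<exists>d. is_half_turn d x \<and> d y = - y)"

lemma orth_iff: "is_half_turn d x \<Longrightarrow> x \<noteq> 0 \<Longrightarrow> orth x y \<longleftrightarrow> d y = - y"
  unfolding orth_def using half_turn_unique by blast

text \<open>Conjugating the half-turn \<open>e\<close> about \<open>y\<close> by \<open>d\<close>
  gives a half-turn about the same line, because \<open>d\<close> negates \<open>y\<close>; so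
  \<open>d\<close> and \<open>e\<close> commute. Then \<open>e x\<close> is fixed by
  \<open>d\<close> and must be \<open>x\<close> or \<open>- x\<close>. The first would put
  \<open>x\<close> on the line of \<open>y\<close>, which \<open>d\<close> negates although it fixes
  \<open>x\<close>.\<close>

lemma orth_sym:
  assumes "orth x y"
  shows "orth y x"
proof (cases "x = 0 \<or> y = 0")
  case True
  then show ?thesis
  proof (cases "y = 0")
    case False
    then obtain d where d: "is_half_turn d y" using ex_half_turn by blast
    then have "d 0 = - 0" using linear linear_0 by (auto simp: is_half_turn_def)
    then show ?thesis using d True False unfolding orth_def by blast
  qed (simp add: orth_def)
next
  case False
  then have nz: "x \<noteq> 0" "y \<noteq> 0" by auto
  obtain d where d: "is_half_turn d x" "d y = - y" using assms nz by (auto simp: orth_def)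
  obtain e where e: "is_half_turn e y" using ex_half_turn nz by blast
  have D: "d \<in> D" "e \<in> D" "\<And>z. d (d z) = z" "\<And>z. e (e z) = z" "d x = x" "e y = y"
    using d e by (auto simp: is_half_turn_def)
  note l = linear[OF D(1)] linear[OF D(2)]
  have "is_half_turn (d \<circ> e \<circ> d) y"
    unfolding is_half_turn_def
  proof (intro conjI allI)
    show "d \<circ> e \<circ> d \<in> D" using comp D by blast
    show "(d \<circ> e \<circ> d) y = y" using D d(2) l by (simp add: linear_neg)
    show "(d \<circ> e \<circ> d) ((d \<circ> e \<circ> d) z) = z" for z using D by simp
    show "d \<circ> e \<circ> d \<noteq> id"
    proof
      assume "d \<circ> e \<circ> d = id"
      then have "d (e (d z)) = z" for z by (metis comp_apply id_apply)
      then have "e z = z" for z using D(3) by metis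
      then show False using e by (auto simp: is_half_turn_def)
    qed
  qed
  then have "d \<circ> e \<circ> d = e" using half_turn_unique e nz by blast
  then have "d (e (d x)) = e x" by (metis comp_apply)
  then have "d (e x) = e x" using D by simp
  then obtain k where k: "e x = k *\<^sub>R x"
    using half_turn_axis[OF d(1) nz(1)] by (auto simp: span_singleton)
  have "(k * k) *\<^sub>R x = 1 *\<^sub>R x" using D(4)[of x] k l by (simp add: linear_scale)
  then have "k * k = 1" using nz by (metis scaleR_right_imp_eq)
  then have "k = 1 \<or> k = - 1" by (simp add: square_eq_1_iff)
  moreover have "k \<noteq> 1"
  proof
    assume "k = 1"
    then have "x \<in> span {y}" using k half_turn_axis[OF e nz(2), of x] by simp
    then obtain c where c: "x = c *\<^sub>R y" by (auto simp: span_singleton)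
    then have "d x = - x" using d l by (simp add: linear_scale)
    then show False using D nz eq_uminus_imp_0 by metis
  qed
  ultimately show ?thesis using k orth_iff[OF e nz(2)] by simp
qed

sublocale orthogonality orth
proof
  show "dim (UNIV :: 'a set) = 3" by (rule dim3)
  show "orth y x" if "orth x y" for x y using that by (rule orth_sym)
  show "orth x (y + z)" if "orth x y" "orth x z" for x y z
  proof (cases "x = 0")
    case False
    then obtain d where d: "is_half_turn d x" using ex_half_turn by blast
    then have "linear d" using linear by (simp add: is_half_turn_def)
    then show ?thesis using that orth_iff[OF d False] by (simp add: linear_add)
  qed (simp add: orth_def)
  show "orth x (c *\<^sub>R y)" if "orth x y" for x y c
  proof (cases "x = 0")
    case False
    then obtain d where d: "is_half_turn d x" using ex_half_turn by blast
    then have "linear d" using linear by (simp add: is_half_turn_def)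
    then show ?thesis using that orth_iff[OF d False] by (simp add: linear_scale)
  qed (simp add: orth_def)
  show "x = 0" if "orth x x" for x
  proof (rule ccontr)
    assume x: "x \<noteq> 0"
    then obtain d where d: "is_half_turn d x" using ex_half_turn by blast
    then show False using orth_iff[OF d x, of x] x that eq_uminus_imp_0 by (auto simp: is_half_turn_def)
  qed
  show "\<exists>c. orth x (y - c *\<^sub>R x)" if x: "x \<noteq> 0" for x y
  proof -
    obtain d where d: "is_half_turn d x" using ex_half_turn x by blast
    obtain a where a: "d y = a *\<^sub>R x - y" using half_turn_add_self[OF d x] .
    \<comment> \<open>Half of \<open>y + d y = a *\<^sub>R x\<close> is the projection of
      \<open>y\<close> onto the axis.\<close>
    have "d (y - (a / 2) *\<^sub>R x) = d y - (a / 2) *\<^sub>R x"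
      using d linear by (simp add: is_half_turn_def linear_diff linear_scale)
    also have "\<dots> = - (y - (a / 2) *\<^sub>R x)"
      by (simp add: a algebra_simps flip: scaleR_add_left)
    finally show ?thesis using orth_iff[OF d x] by blast
  qed
qed

section \<open>Identification of a rotation group with \<open>SO b\<close>\<close>

lemma ex_SO: "\<exists>b\<in>scalar_products. SO b = D"
proof -
  obtain b where b: "b \<in> scalar_products" and orth_b: "\<And>v w. orth v w \<longleftrightarrow> b v w = 0"
    using ex_scalar_product by blast
  interpret b: scalar_product_3 b by unfold_locales (use dim3 b in auto)
  \<comment> \<open>Both half-turns about \<open>x\<close> fix \<open>x\<close> and negate whatever
    is orthogonal to it, and orthogonality means the same for \<open>D\<close> and for
    \<open>b\<close>.\<close>
  have half: "b.half_turn x \<in> D" if x: "x \<noteq> 0" for x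
  proof -
    obtain d where d: "is_half_turn d x" using ex_half_turn x by blast
    then have D: "d \<in> D" "d x = x" by (auto simp: is_half_turn_def)
    have "b.half_turn x y = d y" for y
    proof -
      obtain c where c: "orth x (y - c *\<^sub>R x)" using projection x by blast
      then have 1: "d (y - c *\<^sub>R x) = - (y - c *\<^sub>R x)" using orth_iff[OF d x] by blast
      have 2: "b.half_turn x (y - c *\<^sub>R x) = - (y - c *\<^sub>R x)"
        using c orth_b b.half_turn_orth by blast
      show ?thesis
        using arg_cong2[OF 1 2, of "(-)"] D(2) b.half_turn_self[OF x] linear[OF D(1)]
          b.linear_half_turn[of x]
        by (simp add: linear_diff linear_scale)
    qed
    then show ?thesis using D by (metis ext)
  qed
  obtain v :: 'a where v: "v \<noteq> 0" using ex_orth by blast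
  obtain w where "w \<notin> span {v}" using ex_notin_span_pair[OF dim3, of v v] by auto
  then obtain H L :: "'a set" where flag: "is_flag H L" using v unfolding is_flag_iff by blast
  have image_flag: "is_flag (d ` H) (d ` L)" if "linear d" "inj d" for d
  proof -
    obtain v w where v: "v \<noteq> 0" "w \<notin> span {v}" "H = half_plane v w" "L = ray v"
      using flag unfolding is_flag_iff by blast
    have "d v \<noteq> 0" using that v linear_0 by (metis injD)
    moreover have "d w \<notin> span {d v}"
      using v that linear_span_image[of d "{v}"] by (simp add: inj_image_mem_iff)
    ultimately show ?thesis
      unfolding is_flag_iff using v that by (metis half_plane_image ray_image)
  qed
  \<comment> \<open>Every linear injection agrees on the chosen flag with an element of the
    intersection. Applied to members of \<open>D\<close> and of \<open>SO b\<close>, with uniqueness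
    in the respective group, this gives both inclusions.\<close>
  have common: "\<exists>g. g \<in> D \<inter> SO b \<and> g ` H = d ` H \<and> g ` L = d ` L"
    if "linear d" "inj d" for d
  proof -
    have cl: "f \<circ> g \<in> D \<inter> SO b" if "f \<in> D \<inter> SO b" "g \<in> D \<inter> SO b" for f g
      using that comp b.SO_comp by blast
    have ht: "b.half_turn x \<in> D \<inter> SO b" if "x \<noteq> 0" for x
      using that half b.half_turn_SO by blast
    show ?thesis
      using b.half_turns_transitive_flags[of "D \<inter> SO b", OF cl ht _ flag image_flag[OF that]] linear
      by (metis IntD1)
  qed
  have "D \<subseteq> SO b"
  proof
    fix d assume d: "d \<in> D"
    then obtain g where "g \<in> D \<inter> SO b" "g ` H = d ` H" "g ` L = d ` L"
      using common linear inj by blast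
    moreover from this have "g = d"
      using d by (intro flag_unique[OF flag image_flag[OF linear[OF d] inj[OF d]]]) simp_all
    ultimately show "d \<in> SO b" by blast
  qed
  moreover have "SO b \<subseteq> D"
  proof
    fix d assume d: "d \<in> SO b"
    then have "linear d" "inj d" by (auto simp: SO_def GL_def bij_def)
    then obtain g where "g \<in> D \<inter> SO b" "g ` H = d ` H" "g ` L = d ` L" using common by blast
    moreover from this have "d = g" using b.SO_flag_unique[OF d _ flag] by auto
    ultimately show "d \<in> D" by blast
  qed
  ultimately show ?thesis using b by blast
qed

end

section \<open>The bijection on classes of scalar products\<close>

theorem mainTheorem1:
  assumes "dim (UNIV :: 'a::real_vector set) = 3"
  shows "(SO :: ('a \<Rightarrow> 'a \<Rightarrow> real) \<Rightarrow> ('a \<Rightarrow> 'a) set) respects positive_multiple \<and>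
    bij_betw (\<lambda>C. the_elem (SO ` C))
      ((scalar_products :: ('a \<Rightarrow> 'a \<Rightarrow> real) set) // positive_multiple)
      {D :: ('a \<Rightarrow> 'a) set. rotation_group D}"
proof
  let ?P = "positive_multiple :: (('a \<Rightarrow> 'a \<Rightarrow> real) \<times> _) set"
  let ?S = "scalar_products :: ('a \<Rightarrow> 'a \<Rightarrow> real) set"
  have sp: "scalar_product_3 b" if "b \<in> ?S" for b
    using assms that by (simp add: scalar_product_3_def)
  show resp: "(SO :: ('a \<Rightarrow> 'a \<Rightarrow> real) \<Rightarrow> ('a \<Rightarrow> 'a) set) respects positive_multiple"
    by (auto simp: congruent_def positive_multiple_def SO_scale)
  \<comment> \<open>\<open>SO\<close> is constant on a class, so the image of the class is a
    singleton and \<open>the_elem\<close> returns the value of the induced map.\<close>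
  have elem: "the_elem (SO ` (?P `` {b})) = SO b" if "b \<in> ?S" for b
  proof -
    have "b \<in> ?P `` {b}" using equiv_class_self[OF equiv_positive_multiple that] .
    moreover have "SO b' = SO b" if "b' \<in> ?P `` {b}" for b'
      using that congruentD[OF resp, of b b'] by simp
    ultimately have "SO ` (?P `` {b}) = {SO b}" by blast
    then show ?thesis by simp
  qed
  show "bij_betw (\<lambda>C. the_elem (SO ` C)) (?S // ?P) {D :: ('a \<Rightarrow> 'a) set. rotation_group D}"
    unfolding bij_betw_def
  proof
    show "inj_on (\<lambda>C. the_elem (SO ` C)) (?S // ?P)"
    proof (rule inj_onI)
      fix C C' assume "C \<in> ?S // ?P" "C' \<in> ?S // ?P" and eq: "the_elem (SO ` C) = the_elem (SO ` C')"
      then obtain b b' where b: "b \<in> ?S" "C = ?P `` {b}" "b' \<in> ?S" "C' = ?P `` {b'}"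
        by (auto elim!: quotientE)
      then have "(b, b') \<in> ?P"
        using eq elem scalar_product_3.SO_inj[OF sp] by simp
      then show "C = C'" using equiv_class_eq[OF equiv_positive_multiple] b by simp
    qed
    show "(\<lambda>C. the_elem (SO ` C)) ` (?S // ?P) = {D. rotation_group D}"
    proof (intro equalityI subsetI)
      fix D assume "D \<in> (\<lambda>C. the_elem (SO ` C)) ` (?S // ?P)"
      then obtain b where "b \<in> ?S" "D = SO b" using elem by (auto elim!: quotientE)
      then show "D \<in> {D. rotation_group D}"
        using scalar_product_3.rotation_group_SO[OF sp] by simp
    next
      fix D :: "('a \<Rightarrow> 'a) set" assume "D \<in> {D. rotation_group D}"
      then have "rotation_group_3 D" using assms by (simp add: rotation_group_3_def)
      then obtain b where "b \<in> ?S" "SO b = D" using rotation_group_3.ex_SO by blast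
      then show "D \<in> (\<lambda>C. the_elem (SO ` C)) ` (?S // ?P)"
        using elem by (intro image_eqI[of _ _ "?P `` {b}"]) (auto intro: quotientI)
    qed
  qed
qed

end
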